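(* Fix an integer $N\ge 3$. The number of equivalence classes of set partitions $p$ with $N(p)=N$ distinct letters and length $|p|=2N+1$ such that $\phi_{aba}^{N-1}(p)$ is not sorted equals $\binom{N+1}{2}+2\binom{N}{2}$.
   Context: A set partition is a finite word $p=p_1p_2\cdots p_n$ over an alphabet $A$ (letters may repeat). Its length is $|p|=n$ and $N(p)$ denotes the number of distinct letters occurring in $p$. A set partition is sorted if, for every letter, all occurrences of that letter appear consecutively. Two set partitions $p=p_1\cdots p_n$ and $q=q_1\cdots q_n$ are equivalent if there is a bijection $f:A\to A$ with $q=f(p_1)f(p_2)\cdots f(p_n)$; the property "$\phi_{aba}^{N-1}(p)$ is not sorted" is invariant under equivalence, and the count is of inequivalent such $p$. A word contains the pattern $aba$ if it has a (not necessarily contiguous) subsequence $xyz$ with $x=z\neq y$; otherwise it avoids $aba$. The map $\phi_{aba}$ (Xia's deterministic stack-sorting map for set partitions) is defined as follows. Start with the input $p$, an empty stack, and an empty output. Repeat: if the input is nonempty and pushing its leftmost letter onto the top of the stack would leave the stack contents (read from top to bottom) avoiding the pattern $aba$, then remove that letter from the input and push it onto the stack; otherwise pop the top letter of the stack and append it to the right end of the output. Stop when both input and stack are empty; $\phi_{aba}(p)$ is the output word. For example, $\phi_{aba}(abcac)=cbcaa$. $\phi_{aba}^k$ denotes the $k$-fold iterate. *)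

theory Defs
  imports Main "HOL-Library.Sublist"
begin

text \<open>Set partitions are words (lists) over the alphabet of natural numbers.\<close>

definition avoids_aba :: "'a list \<Rightarrow> bool" where
  "avoids_aba w \<longleftrightarrow> \<not> (\<exists>x y. x \<noteq> y \<and> subseq [x, y, x] w)"

text \<open>The stack is a list whose head is the top of the stack.
  phi_aux input stack returns the output produced from this configuration.\<close>
fun phi_aux :: "'a list \<Rightarrow> 'a list \<Rightarrow> 'a list" where
  "phi_aux [] [] = []"
| "phi_aux [] (y # ys) = y # phi_aux [] ys"
| "phi_aux (x # xs) [] = phi_aux xs [x]"
| "phi_aux (x # xs) (y # ys) =
     (if avoids_aba (x # y # ys) then phi_aux xs (x # y # ys)
      else y # phi_aux (x # xs) ys)"

definition phi_aba :: "'a list \<Rightarrow> 'a list" where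
  "phi_aba p = phi_aux p []"

definition sorted_partition :: "'a list \<Rightarrow> bool" where
  "sorted_partition w \<longleftrightarrow>
     (\<forall>i j k. i < j \<and> j < k \<and> k < length w \<and> w ! i = w ! k \<longrightarrow> w ! j = w ! i)"

definition partition_equiv :: "(nat list \<times> nat list) set" where
  "partition_equiv = {(p, q). \<exists>f. bij f \<and> q = map f p}"

end

theory Submission
  imports Defs "HOL-Combinatorics.Transposition"
begin

text \<open>Call a letter scattered if its occurrences form at least two runs. A letter that is not scattered
  stays so under the map, and the first scattered letter becomes contiguous in every step: below it
  on the stack lie only letters that cause no pop, so it stays there until its last occurrence has
  arrived. Hence an unsorted result after
  \<open>N - 1\<close> steps forces all \<open>N\<close> letters to be scattered at the start, with exactly one of them becoming
  contiguous per step. In length \<open>2 * N + 1\<close> exactly one letter then occurs three times and all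
  others twice. Since no two letters may become contiguous in the same step, the image of such a word is, up to adjacent repetitions, a square \<open>V V\<close> followed by the first letter \<open>a\<close>, and
  conversely such an image stays unsorted long enough. The preimages of \<open>V V a\<close> are the words
  \<open>a X a Y a Z\<close> with \<open>Z Y X = U U\<close>, the words \<open>a U a S t R t Q\<close>, and the words \<open>a S t R t Q a U\<close> with
  \<open>U = S t Q R\<close>, where \<open>U\<close> is the reverse of \<open>V\<close>. Fixing \<open>V\<close> and \<open>a\<close> selects one representative of each
  equivalence class.\<close>

section \<open>A recursion for the stack map\<close>

lemma avoids_aba_Nil [simp]: "avoids_aba []"
  by (simp add: avoids_aba_def)

lemma avoids_aba_singleton [simp]: "avoids_aba [x]"
  by (simp add: avoids_aba_def)

text \<open>A pattern that uses the new head \<open>x\<close> has it as the outer letter. If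
  \<open>x\<close> differs from \<open>y\<close>, then \<open>y\<close> is a middle letter for any
  later \<open>x\<close>; if \<open>x = y\<close>, the same pattern already sits in
  \<open>y # ys\<close>.\<close>

lemma avoids_aba_Cons_Cons [simp]:
  "avoids_aba (x # y # ys) \<longleftrightarrow> avoids_aba (y # ys) \<and> (x = y \<or> x \<notin> set ys)" (is "?l \<longleftrightarrow> ?r")
proof
  assume l: ?l
  then have "avoids_aba (y # ys)"
    unfolding avoids_aba_def by (meson list_emb_Cons)
  moreover have "subseq [x, y, x] (x # y # ys)" if "x \<in> set ys"
    using that by (simp add: subseq_singleton_left)
  ultimately show ?r
    using l unfolding avoids_aba_def by blast
next
  assume r: ?r
  show ?l
    unfolding avoids_aba_def
  proof clarify
    fix u v
    assume uv: "u \<noteq> v" "subseq [u, v, u] (x # y # ys)"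
    show False
    proof (cases "u = x")
      case True
      with uv have "subseq [v, x] (y # ys)" by simp
      then have "x \<in> set ys"
        by (auto simp: subseq_singleton_left split: if_splits dest: list_emb_ConsD elim!: list_emb_set)
      with r have "x = y" by blast
      with uv True have "subseq [y, v, y] (y # ys)"
        by simp
      with uv True r \<open>x = y\<close> show False
        unfolding avoids_aba_def by blast
    next
      case False
      with uv have "subseq [u, v, u] (y # ys)"
        by (simp del: subseq_Cons2_iff split: if_splits)
      with uv r show False
        unfolding avoids_aba_def by blast
    qed
  qed
qed

lemma avoids_aba_Cons_replicate [simp]: "avoids_aba (a # replicate k a)"
  by (induction k) auto

lemma phi_aux_Nil [simp]: "phi_aux [] s = s"
  by (induction s) auto

text \<open>An incoming letter can complete a pattern only with a copy of itself on the stack. No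
  letter of \<open>b\<close> arrives any more, so \<open>b\<close> never forces a pop and leaves the
  stack last.\<close>

lemma phi_aux_append_stack:
  assumes "set xs \<inter> set b = {}" "avoids_aba (s @ b)"
  shows "phi_aux xs (s @ b) = phi_aux xs s @ b"
  using assms
proof (induction xs s rule: phi_aux.induct)
  case (3 x xs)
  then show ?case
    by (cases b) auto
next
  case (4 x xs y ys)
  then have "avoids_aba (ys @ b)"
    by (cases "ys @ b") auto
  moreover have "avoids_aba (y # ys)"
    using 4(4) unfolding avoids_aba_def by (metis append_Cons list_emb_prefix)
  ultimately show ?case using 4 by auto
qed auto

text \<open>The \<open>a\<close>-free input \<open>xs\<close> is processed as if the copies of
  \<open>a\<close> at the bottom were absent. The next \<open>a\<close> would enclose every letter
  still above them, so all of these are emitted before it joins the bottom block.\<close>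

lemma phi_aux_bottom_letter:
  assumes "a \<notin> set xs" "a \<notin> set s" "avoids_aba s"
  shows "phi_aux (xs @ a # ys) (s @ a # replicate k a) = phi_aux xs s @ phi_aux ys (a # a # replicate k a)"
  using assms
proof (induction xs s rule: phi_aux.induct)
  case 1
  show ?case using avoids_aba_Cons_replicate[of a k] by auto
next
  case (2 y ys)
  then have "avoids_aba ys"
    by (cases ys) auto
  moreover have "\<not> avoids_aba (a # y # ys @ a # replicate k a)"
    using 2 by auto
  ultimately show ?case using 2 by simp
next
  case (3 x xs)
  then show ?case by auto
next
  case (4 x xs y ys)
  then have "avoids_aba ys"
    by (cases ys) auto
  moreover have "avoids_aba (s @ a # replicate k a)" if "avoids_aba s" "a \<notin> set s" for s
    using that
  proof (induction s)
    case (Cons z s)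
    then show ?case by (cases s) auto
  qed simp
  from this[of "y # ys"] 4 have "avoids_aba (y # ys @ a # replicate k a)"
    by simp
  ultimately show ?case using 4 by auto
qed

text \<open>Avoidance does not depend on the number of copies in a bottom block. A letter put
  directly on such a block never completes a pattern, so the block is not popped before the input
  ends and surplus copies come out last.\<close>

lemma phi_aux_bottom_replicate:
  "phi_aux xs (s @ a # replicate k a) = phi_aux xs (s @ [a]) @ replicate k a"
proof -
  have eq: "avoids_aba (t @ a # replicate k a) \<longleftrightarrow> avoids_aba (t @ [a])" for t
  proof (induction t)
    case Nil
    show ?case by (induction k) auto
  next
    case (Cons z t)
    then show ?case by (cases t) auto
  qed
  show ?thesis
  proof (induction xs "s @ [a]" arbitrary: s rule: phi_aux.induct)
    case (2 y ys)
    show ?case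
      by simp
  next
    case (4 x xs y ys)
    show ?case
    proof (cases s)
      case Nil
      with 4(1)[of "x # s"] eq[of "[x]"] show ?thesis by (auto simp del: avoids_aba_Cons_Cons) (use 4 in simp_all)
    next
      case (Cons z s')
      with 4 eq[of "x # z # s'"] show ?thesis
        by (cases "avoids_aba (x # z # s' @ [a])") (simp_all del: avoids_aba_Cons_Cons)
    qed
  qed auto
qed

section \<open>Recursion equations for the stack map and first consequences\<close>

lemma phi_Nil [simp]: "phi_aba [] = []"
  by (simp add: phi_aba_def)

lemma phi_Cons_notin: "a \<notin> set xs \<Longrightarrow> phi_aba (a # xs) = phi_aba xs @ [a]"
  using phi_aux_append_stack[of xs "[a]" "[]"] by (simp add: phi_aba_def)

text \<open>The second \<open>a\<close> flushes the image of \<open>xs\<close> and leaves the stack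
  \<open>[a, a]\<close>. One of these copies is split off as the final output letter; the other is
  the stack reached after reading the first letter of \<open>a # ys\<close>.\<close>

lemma phi_Cons_in:
  assumes "a \<notin> set xs"
  shows "phi_aba (a # xs @ a # ys) = phi_aba xs @ phi_aba (a # ys) @ [a]"
  using phi_aux_bottom_letter[of a xs "[]" ys 0] assms phi_aux_bottom_replicate[of ys "[]" a 1]
  by (simp add: phi_aba_def)

text \<open>Induction along the two recursion equations: the first letter does not recur, or the
  word is cut at its first recurrence into two shorter words.\<close>

lemma phi_induct [case_names Nil notin "in"]:
  assumes "P []"
    and "\<And>a xs. a \<notin> set xs \<Longrightarrow> P xs \<Longrightarrow> P (a # xs)"
    and "\<And>a xs ys. a \<notin> set xs \<Longrightarrow> P xs \<Longrightarrow> P (a # ys) \<Longrightarrow> P (a # xs @ a # ys)"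
  shows "P w"
proof (induction w rule: length_induct)
  case (1 w)
  then have IH: "P v" if "length v < length w" for v
    using that by blast
  show ?case
  proof (cases w)
    case Nil
    then show ?thesis using assms(1) by simp
  next
    case (Cons a u)
    show ?thesis
    proof (cases "a \<in> set u")
      case True
      then obtain xs ys where u: "u = xs @ a # ys" "a \<notin> set xs"
        by (meson split_list_first)
      then show ?thesis
        unfolding Cons u(1) by (intro assms(3) IH) (simp_all add: Cons u)
    next
      case False
      then show ?thesis
        unfolding Cons by (intro assms(2) IH) (simp_all add: Cons False)
    qed
  qed
qed

lemma set_phi [simp]: "set (phi_aba w) = set w"
  by (induction w rule: phi_induct) (auto simp: phi_Cons_notin phi_Cons_in)

lemma phi_map: "inj f \<Longrightarrow> phi_aba (map f w) = map f (phi_aba w)"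
  by (induction w rule: phi_induct)
    (simp_all add: phi_Cons_notin phi_Cons_in inj_image_mem_iff)

lemma phi_distinct: "distinct w \<Longrightarrow> phi_aba w = rev w"
  by (induction w) (simp_all add: phi_Cons_notin)

lemma phi_distinct_prefix:
  "distinct s \<Longrightarrow> set s \<inter> set w = {} \<Longrightarrow> phi_aba (s @ w) = phi_aba w @ rev s"
  by (induction s) (simp_all add: phi_Cons_notin)

lemma last_phi_Cons [simp]: "last (phi_aba (a # w)) = a"
proof (cases "a \<in> set w")
  case True
  then obtain xs ys where w: "w = xs @ a # ys" "a \<notin> set xs"
    by (meson split_list_first)
  show ?thesis
    unfolding w(1) phi_Cons_in[OF w(2)] by simp
qed (simp add: phi_Cons_notin)

text \<open>The first letter stays at the bottom of the stack until the input ends, so all its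
  copies are collected at the end of the output.\<close>

lemma phi_Cons_eq_replicate: "\<exists>u k. phi_aba (a # w) = u @ replicate k a \<and> a \<notin> set u"
proof (induction "length w" arbitrary: w rule: less_induct)
  case less
  show ?case
  proof (cases "a \<in> set w")
    case True
    then obtain xs ys where w: "w = xs @ a # ys" "a \<notin> set xs"
      by (meson split_list_first)
    then have "length ys < length w" by simp
    from less[OF this] obtain u k where u: "phi_aba (a # ys) = u @ replicate k a" "a \<notin> set u"
      by (elim exE conjE)
    have "phi_aba (a # w) = (phi_aba xs @ u) @ replicate (Suc k) a"
      unfolding w(1) phi_Cons_in[OF w(2)] u(1) by (simp add: replicate_append_same)
    moreover have "a \<notin> set (phi_aba xs @ u)"
      using u(2) w(2) by simp
    ultimately show ?thesis by (intro exI conjI)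
  next
    case False
    then have "phi_aba (a # w) = phi_aba w @ replicate 1 a" "a \<notin> set (phi_aba w)"
      by (simp_all add: phi_Cons_notin)
    then show ?thesis by (intro exI conjI)
  qed
qed

section \<open>Scattered letters\<close>

text \<open>The entries of \<open>remdups_adj w\<close> correspond to the maximal runs of
  \<open>w\<close>, so the count is the number of runs of \<open>x\<close>.\<close>

definition scattered :: "'a list \<Rightarrow> 'a set" where
  "scattered w = {x. 2 \<le> count_list (remdups_adj w) x}"

lemma runs_Cons: "x \<noteq> a \<Longrightarrow> count_list (remdups_adj (a # w)) x = count_list (remdups_adj w) x"
  by (cases w) auto

text \<open>A letter other than \<open>x\<close> between the two parts keeps runs of
  \<open>x\<close> from merging.\<close>

lemma runs_append_Cons:
  "x \<noteq> a \<Longrightarrow> count_list (remdups_adj (u @ a # w)) x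
     = count_list (remdups_adj u) x + count_list (remdups_adj w) x"
proof (induction u rule: remdups_adj.induct)
  case 1
  then show ?case by (simp add: runs_Cons)
next
  case (2 y)
  then show ?case by (simp add: runs_Cons)
qed auto

lemma runs_append_left: "x \<notin> set u \<Longrightarrow> count_list (remdups_adj (u @ w)) x = count_list (remdups_adj w) x"
  by (induction u) (auto simp: runs_Cons)

lemma runs_append_right: "x \<notin> set w \<Longrightarrow> count_list (remdups_adj (u @ w)) x = count_list (remdups_adj u) x"
  using runs_append_left[of x "rev w" "rev u"] by (metis count_list_rev remdups_adj_rev rev_append set_rev)

lemma scattered_subset: "scattered w \<subseteq> set w"
  using count_list_0_iff[of "remdups_adj w"] by (force simp: scattered_def)

lemma finite_scattered [simp]: "finite (scattered w)"
  by (rule finite_subset[OF scattered_subset]) simp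

lemma scattered_remdups_adj [simp]: "scattered (remdups_adj w) = scattered w"
  by (simp add: scattered_def distinct_adj_altdef[THEN iffD1, OF distinct_adj_remdups_adj])

lemma scattered_append_left: "x \<notin> set u \<Longrightarrow> x \<in> scattered (u @ w) \<longleftrightarrow> x \<in> scattered w"
  by (simp add: scattered_def runs_append_left)

lemma scattered_append_right: "x \<notin> set w \<Longrightarrow> x \<in> scattered (u @ w) \<longleftrightarrow> x \<in> scattered u"
  by (simp add: scattered_def runs_append_right)

lemma runs_pos: "x \<in> set u \<Longrightarrow> 0 < count_list (remdups_adj u) x"
  using count_list_0_iff[of "remdups_adj u" x] by simp

lemma scatteredI: "x \<noteq> a \<Longrightarrow> x \<in> set u \<Longrightarrow> x \<in> set w \<Longrightarrow> x \<in> scattered (u @ a # w)"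
  using runs_pos[of x u] runs_pos[of x w] by (simp add: scattered_def runs_append_Cons)

lemma runs_le_count: "count_list (remdups_adj w) x \<le> count_list w x"
  by (induction w rule: remdups_adj.induct) auto

lemma count_scattered: "x \<in> scattered w \<Longrightarrow> 2 \<le> count_list w x"
  using runs_le_count[of w x] by (simp add: scattered_def)

lemma scattered_distinct_adj: "distinct_adj w \<Longrightarrow> x \<in> scattered w \<longleftrightarrow> 2 \<le> count_list w x"
  by (simp add: scattered_def distinct_adj_altdef)

lemma distinct_count_list_le: "distinct v \<Longrightarrow> count_list v x \<le> 1"
  by (induction v) auto

lemma scattered_empty_iff: "scattered w = {} \<longleftrightarrow> distinct (remdups_adj w)"
proof
  assume *: "scattered w = {}"
  show "distinct (remdups_adj w)"
  proof (rule ccontr)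
    assume "\<not> distinct (remdups_adj w)"
    then obtain xs ys zs y where "remdups_adj w = xs @ [y] @ ys @ [y] @ zs"
      using not_distinct_decomp by blast
    then have "y \<in> scattered w" by (simp add: scattered_def)
    with * show False by blast
  qed
next
  assume "distinct (remdups_adj w)"
  then have "\<not> 2 \<le> count_list (remdups_adj w) x" for x
    using distinct_count_list_le[of "remdups_adj w" x] by linarith
  then show "scattered w = {}"
    by (simp add: scattered_def)
qed

text \<open>This recursion over the first two letters has the shape of the one for
  \<open>remdups_adj\<close>, so that sortedness can be compared with distinctness of the runs by
  induction.\<close>

lemma sorted_partition_Cons_Cons:
  "sorted_partition (x # y # w) \<longleftrightarrow> sorted_partition (y # w) \<and> (x = y \<or> x \<notin> set w)" (is "?l \<longleftrightarrow> ?r")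
proof
  assume l: ?l
  have "sorted_partition (y # w)"
    unfolding sorted_partition_def
  proof (intro allI impI)
    fix i j k
    assume "i < j \<and> j < k \<and> k < length (y # w) \<and> (y # w) ! i = (y # w) ! k"
    then show "(y # w) ! j = (y # w) ! i"
      using l[unfolded sorted_partition_def, rule_format, of "Suc i" "Suc j" "Suc k"] by simp
  qed
  moreover have "x = y" if "x \<in> set w"
  proof -
    from that obtain k where "k < length w" "w ! k = x" by (auto simp: in_set_conv_nth)
    then show ?thesis
      using l[unfolded sorted_partition_def, rule_format, of 0 1 "Suc (Suc k)"] by simp
  qed
  ultimately show ?r by blast
next
  assume r: ?r
  show ?l
    unfolding sorted_partition_def
  proof (intro allI impI)
    fix i j k
    assume *: "i < j \<and> j < k \<and> k < length (x # y # w) \<and> (x # y # w) ! i = (x # y # w) ! k"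
    then obtain j' k' where jk: "j = Suc j'" "k = Suc k'"
      by (cases j; cases k) auto
    show "(x # y # w) ! j = (x # y # w) ! i"
    proof (cases i)
      case 0
      obtain k'' where "k' = Suc k''" using * jk by (cases k') auto
      with * 0 jk have "x \<in> set w" by (auto simp: in_set_conv_nth)
      with r have "x = y" by blast
      then show ?thesis
        using * 0 jk r[unfolded sorted_partition_def, THEN conjunct1, rule_format, of 0 j' k']
        by (cases j') auto
    next
      case (Suc i')
      then show ?thesis
        using * jk r[unfolded sorted_partition_def, THEN conjunct1, rule_format, of i' j' k'] by simp
    qed
  qed
qed

lemma sorted_partition_iff: "sorted_partition w \<longleftrightarrow> scattered w = {}"
  unfolding scattered_empty_iff
proof (induction w rule: remdups_adj.induct)
  case (3 x y w)
  then show ?case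
    by (cases "x = y") (auto simp: sorted_partition_Cons_Cons)
qed (simp_all add: sorted_partition_def)

section \<open>Independence of the run lengths\<close>

lemma remdups_adj_idem [simp]: "remdups_adj (remdups_adj w) = remdups_adj w"
  by (simp flip: distinct_adj_altdef)

lemma remdups_adj_append_remdups_adj:
  "remdups_adj (u @ v) = remdups_adj (remdups_adj u @ remdups_adj v)"
proof (induction u rule: remdups_adj.induct)
  case (2 x)
  show ?case by (simp add: remdups_adj_Cons)
next
  case (3 x y u)
  obtain t where "remdups_adj (y # u) = y # t"
    by (simp add: remdups_adj_Cons')
  with 3 show ?case by simp
qed simp

lemma remdups_adj_append_cong:
  "remdups_adj u = remdups_adj u' \<Longrightarrow> remdups_adj v = remdups_adj v'
    \<Longrightarrow> remdups_adj (u @ v) = remdups_adj (u' @ v')"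
  by (subst (1 2) remdups_adj_append_remdups_adj) simp

lemma remdups_adj_snoc_last: "u \<noteq> [] \<Longrightarrow> last u = a \<Longrightarrow> remdups_adj (u @ [a]) = remdups_adj u"
  by (induction u rule: remdups_adj.induct) auto

text \<open>A doubled first letter only appends another \<open>a\<close> to an output that already
  ends in \<open>a\<close>. Otherwise collapsing runs commutes with the cut at the second
  \<open>a\<close>, because \<open>xs\<close> is nonempty and free of \<open>a\<close>.\<close>

lemma remdups_adj_phi_remdups_adj: "remdups_adj (phi_aba (remdups_adj w)) = remdups_adj (phi_aba w)"
proof (induction w rule: phi_induct)
  case (notin a xs)
  then have "remdups_adj (a # xs) = a # remdups_adj xs"
    by (cases xs) auto
  then have "phi_aba (remdups_adj (a # xs)) = phi_aba (remdups_adj xs) @ [a]"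
    using notin(1) by (simp add: phi_Cons_notin)
  from this phi_Cons_notin[OF notin(1)] show ?case
    by (simp only:) (intro remdups_adj_append_cong notin(2) refl)
next
  case ("in" a xs ys)
  show ?case
  proof (cases "xs = []")
    case True
    have ne: "phi_aba (a # ys) \<noteq> []"
      using set_phi[of "a # ys"] by force
    have "phi_aba (a # xs @ a # ys) = phi_aba (a # ys) @ [a]"
      using phi_Cons_in[of a "[]" ys] True by simp
    then show ?thesis
      using "in" True by (simp add: remdups_adj_snoc_last ne)
  next
    case False
    obtain t where t: "remdups_adj (a # ys) = a # t"
      by (simp add: remdups_adj_Cons')
    have "last xs \<noteq> a"
      using False "in"(1) by (metis last_in_set)
    then have "remdups_adj (xs @ a # ys) = remdups_adj xs @ a # t"
      using remdups_adj_append'[of xs "a # ys"] t by simp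
    moreover have "remdups_adj (a # xs @ a # ys) = a # remdups_adj (xs @ a # ys)"
      using False "in"(1) by (cases xs) auto
    moreover have "a \<notin> set (remdups_adj xs)"
      using "in"(1) by simp
    ultimately have "phi_aba (remdups_adj (a # xs @ a # ys))
        = phi_aba (remdups_adj xs) @ phi_aba (remdups_adj (a # ys)) @ [a]"
      by (simp add: phi_Cons_in t)
    from this phi_Cons_in[OF "in"(1)] show ?thesis
      by (simp only:) (intro remdups_adj_append_cong "in"(2,3) refl)
  qed
qed simp

lemma remdups_adj_phi_pow: "remdups_adj ((phi_aba ^^ k) (remdups_adj w)) = remdups_adj ((phi_aba ^^ k) w)"
proof (induction k)
  case (Suc k)
  then show ?case
    using remdups_adj_phi_remdups_adj[of "(phi_aba ^^ k) w"]
      remdups_adj_phi_remdups_adj[of "(phi_aba ^^ k) (remdups_adj w)"] by simp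
qed simp

lemma scattered_phi_pow_remdups_adj:
  "scattered ((phi_aba ^^ k) (remdups_adj w)) = scattered ((phi_aba ^^ k) w)"
  using remdups_adj_phi_pow[of k w] by (simp add: scattered_def)

section \<open>Loss of scattered letters in each step\<close>

lemma hd_not_scattered_phi: "a \<notin> scattered (phi_aba (a # w))"
proof -
  from phi_Cons_eq_replicate[of a w]
  obtain u k where u: "phi_aba (a # w) = u @ replicate k a" "a \<notin> set u"
    by (elim exE conjE)
  show ?thesis
    unfolding u(1) using u(2)
    by (simp add: scattered_append_left) (simp add: scattered_def remdups_adj_replicate)
qed

text \<open>The two blocks around the second \<open>a\<close> are mapped separately and
  concatenated. A letter in both blocks is already separated by that \<open>a\<close> in the input,
  a letter in only one is covered by induction, and the first letter itself is contiguous in the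
  image.\<close>

lemma scattered_phi: "x \<in> scattered (phi_aba w) \<Longrightarrow> x \<in> scattered w"
proof (induction w rule: phi_induct)
  case (notin a xs)
  show ?case
  proof (cases "x = a")
    case True
    with notin(3) hd_not_scattered_phi show ?thesis by fastforce
  next
    case False
    with notin have "x \<in> scattered (phi_aba xs)"
      by (simp add: phi_Cons_notin scattered_append_right)
    with notin False show ?thesis
      using scattered_append_left[of x "[a]" xs] by simp
  qed
next
  case ("in" a xs ys)
  have na: "x \<noteq> a"
    using "in"(4) hd_not_scattered_phi by fastforce
  have mem: "x \<in> scattered (phi_aba xs @ phi_aba (a # ys))"
    using "in"(1,4) na scattered_append_right[of x "[a]" "phi_aba xs @ phi_aba (a # ys)"]
    by (simp add: phi_Cons_in)
  have *: "x \<in> scattered (a # xs @ a # ys) \<longleftrightarrow> x \<in> scattered (xs @ a # ys)"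
    using na scattered_append_left[of x "[a]"] by simp
  consider "x \<in> set xs" "x \<in> set ys" | "x \<notin> set xs" | "x \<notin> set ys" by blast
  then show ?case
  proof cases
    case 1
    then show ?thesis using na * scatteredI by fast
  next
    case 2
    then have "x \<in> scattered (a # ys)"
      using mem "in"(3) scattered_append_left[of x "phi_aba xs" "phi_aba (a # ys)"] by simp
    with 2 * show ?thesis
      using scattered_append_left[of x xs "a # ys"] by simp
  next
    case 3
    then have "x \<in> scattered xs"
      using mem "in"(2) na scattered_append_right[of x "phi_aba (a # ys)" "phi_aba xs"] by simp
    with 3 na * show ?thesis
      using scattered_append_right[of x "a # ys" xs] by simp
  qed
qed (simp add: scattered_def)

lemma first_repeated_split:
  assumes "\<not> distinct w"
  obtains s y z where "w = s @ y # z" "y \<in> set z" "distinct s" "set s \<inter> set (y # z) = {}"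
proof -
  have "\<exists>s y z. w = s @ y # z \<and> y \<in> set z \<and> distinct s \<and> set s \<inter> set (y # z) = {}"
    using assms
  proof (induction w)
    case (Cons a w)
    show ?case
    proof (cases "a \<in> set w")
      case True
      then show ?thesis by (intro exI[of _ "[]"]) auto
    next
      case False
      with Cons obtain s y z where "w = s @ y # z" "y \<in> set z" "distinct s" "set s \<inter> set (y # z) = {}"
        by auto
      with False show ?thesis
        by (intro exI[of _ "a # s"] exI[of _ y] exI[of _ z]) auto
    qed
  qed simp
  with that show ?thesis by blast
qed

text \<open>The letters of \<open>s\<close> never recur, so they rest at the bottom of the stack and
  \<open>y\<close> acts as the first letter of the remaining input.\<close>

lemma first_repeated_not_scattered:
  assumes "distinct s" "set s \<inter> set (y # z) = {}"
  shows "y \<notin> scattered (phi_aba (s @ y # z))"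
  using assms hd_not_scattered_phi[of y z] scattered_append_right[of y "rev s"]
  by (simp add: phi_distinct_prefix)

lemma exists_repeated_not_scattered:
  assumes "\<not> distinct w"
  obtains y where "2 \<le> count_list w y" "y \<notin> scattered (phi_aba w)"
proof -
  obtain s y z where w: "w = s @ y # z" "y \<in> set z" "distinct s" "set s \<inter> set (y # z) = {}"
    using first_repeated_split[OF assms] .
  have "count_list z y \<noteq> 0"
    using w(2) by (simp add: count_list_0_iff)
  then show thesis
    using that[of y] first_repeated_not_scattered[OF w(3,4)] w(1) by simp
qed

lemma card_scattered_phi_less:
  assumes "scattered w \<noteq> {}"
  shows "card (scattered (phi_aba w)) < card (scattered w)"
proof -
  \<comment> \<open>After collapsing runs, repeated letters are the same as scattered ones, and
    collapsing does not change which letters the step leaves scattered.\<close>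
  have nd: "\<not> distinct (remdups_adj w)"
    using assms by (simp add: scattered_empty_iff)
  obtain y where y: "2 \<le> count_list (remdups_adj w) y" "y \<notin> scattered (phi_aba (remdups_adj w))"
    using exists_repeated_not_scattered[OF nd] .
  then have "y \<in> scattered w" "y \<notin> scattered (phi_aba w)"
    using scattered_phi_pow_remdups_adj[of 1 w] by (auto simp: scattered_def)
  then have "scattered (phi_aba w) \<subset> scattered w"
    using scattered_phi[of _ w] by (auto simp only: psubset_eq subset_eq)
  then show ?thesis
    by (simp add: psubset_card_mono)
qed

lemma card_scattered_phi_pow:
  "scattered ((phi_aba ^^ k) w) \<noteq> {} \<Longrightarrow> card (scattered ((phi_aba ^^ k) w)) + k \<le> card (scattered w)"
proof (induction k)
  case (Suc k)
  let ?v = "(phi_aba ^^ k) w"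
  have ne: "scattered ?v \<noteq> {}"
    using Suc.prems scattered_phi[of _ ?v] by auto
  from Suc.IH[OF ne] card_scattered_phi_less[OF ne] show ?case
    by simp
qed simp

text \<open>Every step loses at least one scattered letter and one must be left after
  \<open>k + 1\<close> steps. Starting from \<open>k + 2\<close> there is no slack, so the first
  step loses exactly one.\<close>

lemma scattered_critical:
  assumes "card (scattered w) = Suc (Suc k)" "scattered ((phi_aba ^^ Suc k) w) \<noteq> {}"
  shows "card (scattered (phi_aba w)) = Suc k"
    and "scattered ((phi_aba ^^ k) (phi_aba w)) \<noteq> {}"
    and "y \<in> scattered w \<Longrightarrow> y \<notin> scattered (phi_aba w) \<Longrightarrow>
         z \<in> scattered w \<Longrightarrow> z \<notin> scattered (phi_aba w) \<Longrightarrow> y = z"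
proof -
  show ne: "scattered ((phi_aba ^^ k) (phi_aba w)) \<noteq> {}"
    using assms(2) by (simp add: funpow_swap1)
  then have "0 < card (scattered ((phi_aba ^^ k) (phi_aba w)))"
    by (simp add: card_gt_0_iff)
  moreover have "scattered w \<noteq> {}"
    using assms(1) by auto
  ultimately show c: "card (scattered (phi_aba w)) = Suc k"
    using card_scattered_phi_pow[OF ne] card_scattered_phi_less[of w] assms(1) by linarith
  assume yz: "y \<in> scattered w" "y \<notin> scattered (phi_aba w)" "z \<in> scattered w" "z \<notin> scattered (phi_aba w)"
  have "card (scattered w - scattered (phi_aba w)) = 1"
    using c assms(1) scattered_phi[of _ w] by (subst card_Diff_subset) auto
  with yz show "y = z"
    by (metis (no_types, lifting) DiffI card_1_singletonE singletonD)
qed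

section \<open>Squares\<close>

lemma phi_distinct_prefix_twice:
  assumes "distinct s" "set s \<inter> set (a # Q @ a # R) = {}" "a \<notin> set Q" "a \<notin> set R"
  shows "phi_aba (s @ a # Q @ a # R) = (phi_aba Q @ phi_aba R) @ a # a # rev s"
  using assms by (simp add: phi_distinct_prefix phi_Cons_in phi_Cons_notin)

lemma remdups_adj_double: "remdups_adj (u @ a # a # v) = remdups_adj (u @ a # v)"
  by (rule remdups_adj_append_cong) simp_all

lemma not_scattered_append:
  assumes "x \<notin> set u" "x \<notin> set v" "x \<notin> scattered w"
  shows "x \<notin> scattered (u @ w @ v)"
  using assms scattered_append_left[of x u "w @ v"] scattered_append_right[of x v w] by simp

lemma not_distinct_adj_decomp:
  "\<not> distinct_adj w \<Longrightarrow> \<exists>p y q. w = p @ [y, y] @ q"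
proof (induction w rule: remdups_adj.induct)
  case (3 x y w)
  show ?case
  proof (cases "x = y")
    case True
    then have "x # y # w = [] @ [x, x] @ w" by simp
    then show ?thesis by (intro exI)
  next
    case False
    with 3 obtain p z q where "y # w = p @ [z, z] @ q" by auto
    then have "x # y # w = (x # p) @ [z, z] @ q" by simp
    then show ?thesis by (intro exI)
  qed
qed auto

text \<open>An adjacent pair uses up both occurrences of its letter and so makes it
  contiguous.\<close>

lemma distinct_adjI_scattered:
  assumes "\<And>x. count_list u x \<le> 2" "\<And>x. count_list u x = 2 \<Longrightarrow> x \<in> scattered u"
  shows "distinct_adj u"
proof (rule ccontr)
  assume "\<not> distinct_adj u"
  then obtain p y q where u: "u = p @ [y, y] @ q"
    using not_distinct_adj_decomp by blast
  with assms(1)[of y] have "count_list p y = 0" "count_list q y = 0"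
    by simp_all
  then have "y \<notin> set p" "y \<notin> set q" "count_list u y = 2"
    using u by (simp_all add: count_list_0_iff)
  moreover have "y \<notin> scattered [y, y]"
    by (simp add: scattered_def)
  ultimately show False
    using assms(2)[of y] not_scattered_append[of y p q "[y, y]"] u by simp
qed

lemma distinctI_count_list: "(\<And>x. count_list w x \<le> 1) \<Longrightarrow> distinct w"
proof (induction w)
  case (Cons a w)
  have "count_list w a = 0"
    using Cons.prems[of a] by simp
  moreover have "count_list w x \<le> 1" for x
    using Cons.prems[of x] by (simp split: if_splits)
  ultimately show ?case
    using Cons.IH by (simp add: count_list_0_iff)
qed simp

lemma count_list_filter: "count_list (filter P w) x = (if P x then count_list w x else 0)"
  by (induction w) auto

lemma filter_eq_replicate_count: "filter (\<lambda>y. y = x) w = replicate (count_list w x) x"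
  by (induction w) auto

text \<open>Induction on the number of steps. The first repeated letter \<open>a\<close> becomes
  contiguous, so by criticality no other letter does. Hence neither the block \<open>Q\<close>
  between its occurrences nor the block \<open>R\<close> after them repeats a letter, the image is
  \<open>rev Q @ rev R @ a # a # rev s\<close>, and a square among its scattered letters pulls back
  to one in \<open>w\<close>.\<close>

lemma scattered_double_word:
  assumes "distinct_adj w" "\<And>x. x \<in> scattered w \<Longrightarrow> count_list w x = 2"
    and "card (scattered w) = Suc k" "scattered ((phi_aba ^^ k) w) \<noteq> {}"
  shows "\<exists>V. filter (\<lambda>x. x \<in> scattered w) w = V @ V"
  using assms
proof (induction k arbitrary: w)
  case 0
  then obtain b where b: "scattered w = {b}"
    using card_1_singletonE by (metis One_nat_def)
  have "filter (\<lambda>x. x \<in> scattered w) w = [b] @ [b]"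
    unfolding b using 0(2)[of b] b by (simp add: filter_eq_replicate_count numeral_2_eq_2)
  then show ?case by blast
next
  case (Suc k)
  note crit = scattered_critical[OF Suc.prems(3,4)]
  have count_le: "count_list w x \<le> 2" for x
    using Suc.prems(2)[of x] scattered_distinct_adj[OF Suc.prems(1), of x] by linarith
  have "scattered w \<noteq> {}"
    using Suc.prems(3) by auto
  then have "\<not> distinct w"
    using Suc.prems(1) by (simp add: scattered_empty_iff distinct_adj_altdef)
  then obtain s a z where w: "w = s @ a # z" "a \<in> set z" "distinct s" "set s \<inter> set (a # z) = {}"
    using first_repeated_split by metis
  from w(2) obtain Q R where z: "z = Q @ a # R" "a \<notin> set Q"
    by (meson split_list_first)
  have "a \<notin> set R"
    using count_le[of a] w z by (simp add: count_list_0_iff)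
  then have aR: "a \<notin> set R" and as: "a \<notin> set s" and aQ: "a \<notin> set Q"
    using w z by auto
  have phi: "phi_aba w = (phi_aba Q @ phi_aba R) @ a # a # rev s"
    unfolding w(1) z(1) by (rule phi_distinct_prefix_twice) (use w z aR in auto)
  have counts: "count_list w x = count_list s x + count_list Q x + count_list R x + (if x = a then 2 else 0)" for x
    using w z by simp
  have a_sc: "a \<in> scattered w"
    using counts[of a] scattered_distinct_adj[OF Suc.prems(1), of a] by simp
  have a_not: "a \<notin> scattered (phi_aba w)"
    using first_repeated_not_scattered[OF w(3,4)] w(1) by simp
  have other: "x \<in> scattered (phi_aba w)" if "x \<noteq> a" "2 \<le> count_list w x" for x
    using that crit(3)[OF a_sc a_not, of x] scattered_distinct_adj[OF Suc.prems(1), of x] by blast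
  \<comment> \<open>A letter repeated inside \<open>Q\<close> has no copies elsewhere, so it would
    become contiguous in the same step as \<open>a\<close>. The argument for \<open>R\<close> is the
    same.\<close>
  have distQ: "distinct Q"
  proof (rule ccontr)
    assume "\<not> distinct Q"
    then obtain y where y: "2 \<le> count_list Q y" "y \<notin> scattered (phi_aba Q)"
      using exists_repeated_not_scattered[of Q] by metis
    have "y \<noteq> a"
      using y(1) aQ by auto
    then have "count_list R y = 0" "count_list s y = 0"
      using counts[of y] count_le[of y] y(1) by simp_all
    then have "y \<notin> set (phi_aba R @ a # a # rev s)"
      using \<open>y \<noteq> a\<close> by (simp add: count_list_0_iff)
    with y(2) have "y \<notin> scattered (phi_aba w)"
      using phi scattered_append_right[of y "phi_aba R @ a # a # rev s" "phi_aba Q"] by simp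
    with other[OF \<open>y \<noteq> a\<close>] y(1) counts[of y] show False by simp
  qed
  have distR: "distinct R"
  proof (rule ccontr)
    assume "\<not> distinct R"
    then obtain y where y: "2 \<le> count_list R y" "y \<notin> scattered (phi_aba R)"
      using exists_repeated_not_scattered[of R] by metis
    have "y \<noteq> a"
      using y(1) aR by auto
    then have "count_list Q y = 0" "count_list s y = 0"
      using counts[of y] count_le[of y] y(1) by simp_all
    then have "y \<notin> set (phi_aba Q)" "y \<notin> set (a # a # rev s)"
      using \<open>y \<noteq> a\<close> by (simp_all add: count_list_0_iff)
    with y(2) have "y \<notin> scattered (phi_aba w)"
      using phi not_scattered_append[of y "phi_aba Q" "a # a # rev s" "phi_aba R"] by simp
    with other[OF \<open>y \<noteq> a\<close>] y(1) counts[of y] show False by simp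
  qed
  define u where "u = rev Q @ rev R"
  define w' where "w' = u @ a # rev s"
  have phi_u: "phi_aba w = u @ a # a # rev s"
    using phi by (simp add: phi_distinct distQ distR u_def)
  have sc_u: "x \<in> scattered u" if "x \<in> scattered (phi_aba w)" "x \<notin> set s" for x
    using that a_not phi_u scattered_append_right[of x "a # a # rev s" u] by (cases "x = a") auto
  \<comment> \<open>A letter on both sides of the junction of \<open>rev Q\<close> and
    \<open>rev R\<close> would be contiguous in the image, but as a repeated letter other than
    \<open>a\<close> it is still scattered.\<close>
  have adj_u: "distinct_adj u"
  proof (rule distinct_adjI_scattered)
    show "count_list u x \<le> 2" for x
      using count_le[of x] counts[of x] by (simp add: u_def)
    fix x assume x: "count_list u x = 2"
    then have xa: "x \<noteq> a"
      using aQ aR by (auto simp: u_def)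
    have "count_list s x = 0"
      using x count_le[of x] counts[of x] by (simp add: u_def)
    with x xa show "x \<in> scattered u"
      using sc_u[of x] other[of x] counts[of x] by (simp add: u_def count_list_0_iff)
  qed
  have "distinct (a # rev s)"
    using w(3) as by simp
  then have "distinct_adj (a # rev s)"
    by (simp add: distinct_adj_altdef remdups_adj_distinct)
  moreover have "u = [] \<or> last u \<noteq> a"
    using aQ aR last_in_set[of u] by (auto simp: u_def)
  ultimately have adj_w': "distinct_adj w'"
    using adj_u by (auto simp: w'_def distinct_adj_append_iff)
  then have rem: "remdups_adj (phi_aba w) = w'"
    by (simp add: phi_u remdups_adj_double w'_def distinct_adj_altdef)
  have sc_w': "scattered w' = scattered (phi_aba w)"
    using scattered_remdups_adj[of "phi_aba w"] rem by simp
  have sc_w: "scattered w = insert a (scattered w')"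
    using sc_w' other a_sc scattered_phi[of _ w] scattered_distinct_adj[OF Suc.prems(1)] by auto
  \<comment> \<open>Letters of \<open>s\<close> occur nowhere else. A surviving letter therefore has
    its two occurrences in the blocks, at most one in each.\<close>
  have cnt_w': "count_list Q x = 1 \<and> count_list R x = 1 \<and> count_list s x = 0" if "x \<in> scattered w'" for x
  proof -
    have xa: "x \<noteq> a"
      using that sc_w' a_not by auto
    have "count_list w x = 2"
      using that sc_w Suc.prems(2)[of x] by simp
    moreover have "count_list s x = 0"
    proof (rule ccontr)
      assume "count_list s x \<noteq> 0"
      then have "x \<in> set s"
        by (meson count_list_0_iff)
      with w(4) z have "count_list Q x = 0" "count_list R x = 0" "count_list s x \<le> 1"
        using distinct_count_list_le[OF w(3)] by (auto simp: count_list_0_iff)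
      with \<open>count_list w x = 2\<close> xa counts[of x] show False by simp
    qed
    moreover have "count_list Q x \<le> 1" "count_list R x \<le> 1"
      using distinct_count_list_le[OF distQ, of x] distinct_count_list_le[OF distR, of x] .
    ultimately show ?thesis
      using counts[of x] xa by simp
  qed
  have "\<exists>V. filter (\<lambda>x. x \<in> scattered w') w' = V @ V"
  proof (rule Suc.IH)
    show "count_list w' x = 2" if "x \<in> scattered w'" for x
      using cnt_w'[OF that] that a_not sc_w' by (auto simp: w'_def u_def)
    show "card (scattered w') = Suc k"
      using crit(1) sc_w' by simp
    show "scattered ((phi_aba ^^ k) w') \<noteq> {}"
      using crit(2) scattered_phi_pow_remdups_adj[of k "phi_aba w"] rem by simp
  qed (rule adj_w')
  then obtain V where V: "filter (\<lambda>x. x \<in> scattered w') w' = V @ V"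
    by blast
  let ?f = "filter (\<lambda>x. x \<in> scattered w')"
  have "x \<in> set Q \<and> x \<in> set R \<and> x \<notin> set s" if "x \<in> scattered w'" for x
    using cnt_w'[OF that] count_list_0_iff[of Q x] count_list_0_iff[of R x] count_list_0_iff[of s x] by simp
  then have sub: "scattered w' \<subseteq> set Q" "scattered w' \<subseteq> set R" "scattered w' \<inter> set s = {}"
    by blast+
  have s_empty: "?f s = []"
    using sub(3) by (auto simp: filter_empty_conv)
  \<comment> \<open>Both blocks contain each surviving letter exactly once, so the boundary between
    them cuts the square \<open>V @ V\<close> in the middle.\<close>
  have "set (?f Q) = scattered w'" "set (?f R) = scattered w'"
    using sub by auto
  then have len: "length (?f Q) = length (?f R)"
    using distinct_card[of "?f Q"] distinct_card[of "?f R"] distQ distR by simp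
  have VV: "rev (?f Q) @ rev (?f R) = V @ V"
    using V s_empty a_not sc_w' by (simp add: w'_def u_def flip: rev_filter)
  then have "length (?f Q) + length (?f R) = length V + length V"
    by (metis length_append length_rev)
  with len have lenV: "length (rev (?f Q)) = length V" by simp
  have "rev (?f Q) = V" "rev (?f R) = V"
    using VV append_eq_append_conv[OF disjI1, OF lenV, of "rev (?f R)" V] by blast+
  then have QR: "?f Q = rev V" "?f R = rev V"
    by auto
  have "filter (\<lambda>x. x \<in> scattered w) Q = ?f Q" "filter (\<lambda>x. x \<in> scattered w) R = ?f R"
    "filter (\<lambda>x. x \<in> scattered w) s = ?f s"
    using aQ aR as by (auto simp: sc_w intro!: filter_cong)
  then have "filter (\<lambda>x. x \<in> scattered w) w = (a # rev V) @ (a # rev V)"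
    using w(1) z(1) a_sc QR s_empty by simp
  then show ?case by blast
qed

lemma filter_eq_appendE:
  assumes "filter P w = ys @ zs"
  obtains u v where "w = u @ v" "filter P u = ys" "filter P v = zs"
proof -
  have "\<exists>u v. w = u @ v \<and> filter P u = ys \<and> filter P v = zs"
    using assms
  proof (induction w arbitrary: ys)
    case (Cons a w)
    show ?case
    proof (cases "P a \<and> ys = []")
      case True
      with Cons.prems show ?thesis
        by (intro exI[of _ "[]"] exI[of _ "a # w"]) simp
    next
      case False
      with Cons.prems have "filter P w = (if P a then tl ys else ys) @ zs"
        by (cases ys) auto
      from Cons.IH[OF this] obtain u v
        where "w = u @ v" "filter P u = (if P a then tl ys else ys)" "filter P v = zs"
        by (elim exE conjE)
      with False Cons.prems show ?thesis
        by (intro exI[of _ "a # u"] exI[of _ v]) (cases ys; auto)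
    qed
  qed simp
  then show thesis
    by (elim exE conjE) (rule that)
qed

text \<open>Without a final letter outside \<open>V\<close>, which separates the two occurrences of the last remaining
  letter, that letter could become contiguous one step too early, as in \<open>abab\<close>.\<close>

lemma scattered_phi_pow_double_word:
  assumes "distinct_adj w" "distinct V" "filter (\<lambda>x. x \<in> set V) w = V @ V"
    and "\<And>x. x \<notin> set V \<Longrightarrow> count_list w x \<le> 1" "last w \<notin> set V" "length V = Suc k"
  shows "scattered ((phi_aba ^^ k) w) \<noteq> {}"
  using assms
proof (induction k arbitrary: w V)
  case 0
  then obtain b where "V = [b]"
    by (metis length_0_conv length_Suc_conv)
  with 0(3) have "count_list w b = 2"
    using count_list_filter[of "\<lambda>x. x \<in> set V" w b] by simp
  then show ?case
    using scattered_distinct_adj[OF 0(1), of b] by auto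
next
  case (Suc k)
  note cnt = Suc.prems(4)
  obtain b V' where V: "V = b # V'"
    using Suc.prems(6) by (cases V) auto
  let ?f = "filter (\<lambda>x. x \<in> set V)"
  \<comment> \<open>The word is cut at the two occurrences of \<open>b\<close>, the first letter of
    \<open>V\<close>. The part before the first one has no letters of \<open>V\<close>; the block
    between them and the block after them each restrict to \<open>V'\<close>.\<close>
  obtain s z where w: "w = s @ b # z" "\<forall>x\<in>set s. x \<notin> set V" "?f z = V' @ V"
    using Suc.prems(3) unfolding V by (auto simp: filter_eq_Cons_iff)
  obtain z1 z2 where z: "z = z1 @ z2" "?f z1 = V'" "?f z2 = b # V'"
    using filter_eq_appendE[OF w(3)] unfolding V .
  then obtain z3 R where z2: "z2 = z3 @ b # R" "\<forall>x\<in>set z3. x \<notin> set V" "?f R = V'"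
    by (auto simp: filter_eq_Cons_iff)
  define Q where "Q = z1 @ z3"
  have wQR: "w = s @ b # Q @ b # R"
    using w z z2 by (simp add: Q_def)
  have fQ: "?f Q = V'"
    using z(2) z2(2) by (simp add: Q_def filter_empty_conv)
  have fR: "?f R = V'" by (rule z2(3))
  have bV: "b \<in> set V"
    using V by simp
  have bV': "b \<notin> set V'" and dV': "distinct V'"
    using Suc.prems(2) V by auto
  have bQ: "b \<notin> set Q"
    using arg_cong[OF fQ, of set] bV' bV by auto
  have bR: "b \<notin> set R"
    using arg_cong[OF fR, of set] bV' bV by auto
  have bs: "b \<notin> set s"
    using w(2) V by auto
  have counts: "count_list w x = count_list s x + count_list Q x + count_list R x + (if x = b then 2 else 0)" for x
    using wQR by simp
  have inV: "count_list Q x = 1 \<and> count_list R x = 1 \<and> count_list s x = 0" if "x \<in> set V'" for x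
  proof -
    have "count_list V' x = 1"
      using that dV' distinct_count_list_le[OF dV', of x] count_list_0_iff[of V' x] by linarith
    moreover have "x \<notin> set s"
      using w(2) that V by auto
    ultimately show ?thesis
      using count_list_filter[of "\<lambda>x. x \<in> set V" Q x] count_list_filter[of "\<lambda>x. x \<in> set V" R x] fQ fR that V
      by simp
  qed
  have notV: "count_list s x + count_list Q x + count_list R x \<le> 1" if "x \<notin> set V'" for x
  proof (cases "x = b")
    case True
    then show ?thesis using bs bQ bR by simp
  next
    case False
    then show ?thesis using counts[of x] cnt[of x] that V by simp
  qed
  have dists: "distinct s" "distinct Q" "distinct R"
  proof -
    have "count_list s x \<le> 1" "count_list Q x \<le> 1" "count_list R x \<le> 1" for x
      using inV[of x] notV[of x] by (cases "x \<in> set V'"; simp)+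
    then show "distinct s" "distinct Q" "distinct R"
      by (auto intro: distinctI_count_list)
  qed
  have disj: "set s \<inter> set (b # Q @ b # R) = {}"
  proof -
    have "x \<notin> set Q \<and> x \<notin> set R" if "x \<in> set s" for x
    proof -
      have "x \<notin> set V'" "count_list s x \<noteq> 0"
        using that w(2) V by (auto simp: count_list_0_iff)
      with notV[of x] show ?thesis
        by (simp add: count_list_0_iff[symmetric])
    qed
    with bs show ?thesis by auto
  qed
  define w' where "w' = rev Q @ rev R @ b # rev s"
  have phi: "phi_aba w = (rev Q @ rev R) @ b # b # rev s"
    unfolding wQR using phi_distinct_prefix_twice[OF dists(1) disj bQ bR] dists by (simp add: phi_distinct)
  have V'_ne: "V' \<noteq> []"
    using Suc.prems(6) V by auto
  then have ne: "Q \<noteq> []" "R \<noteq> []"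
    using fQ fR by auto
  \<comment> \<open>At the junction of \<open>rev Q\<close> and \<open>rev R\<close> the letters
    \<open>hd Q\<close> and \<open>last R\<close> meet. The latter is the last letter of
    \<open>w\<close>; it lies outside \<open>V\<close>, occurs only once, and hence is not in
    \<open>Q\<close>.\<close>
  have lastR: "last R \<notin> set V"
    using Suc.prems(5) wQR ne by simp
  then have "count_list R (last R) \<noteq> 0" "last R \<notin> set V'"
    using ne V by (auto simp: count_list_0_iff)
  then have "last R \<notin> set Q"
    using notV[of "last R"] by (simp add: count_list_0_iff[symmetric])
  then have "last R \<noteq> hd Q"
    using ne by auto
  moreover have "distinct_adj Q" "distinct_adj R" "distinct_adj (b # rev s)"
    using dists bs by (simp_all add: distinct_adj_altdef remdups_adj_distinct)
  moreover have "hd R \<noteq> b"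
    using ne bR by auto
  ultimately have adj: "distinct_adj w'"
    using ne by (simp add: w'_def distinct_adj_append_iff hd_append hd_rev last_rev)
  then have rem: "remdups_adj (phi_aba w) = w'"
    using remdups_adj_double[of "rev Q @ rev R" b "rev s"] by (simp add: phi w'_def distinct_adj_altdef)
  have "scattered ((phi_aba ^^ k) w') \<noteq> {}"
  proof (rule Suc.IH)
    show "distinct (rev V')" "length (rev V') = Suc k"
      using dV' Suc.prems(6) V by auto
    have "filter (\<lambda>x. x \<in> set (rev V')) Q = ?f Q" "filter (\<lambda>x. x \<in> set (rev V')) R = ?f R"
      using bQ bR by (intro filter_cong refl; auto simp: V)+
    then have "filter (\<lambda>x. x \<in> set (rev V')) Q = V'" "filter (\<lambda>x. x \<in> set (rev V')) R = V'"
      using fQ fR by (simp_all only:)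
    moreover have "filter (\<lambda>x. x \<in> set (rev V')) s = []"
      using w(2) V by (auto simp: filter_empty_conv)
    ultimately show "filter (\<lambda>x. x \<in> set (rev V')) w' = rev V' @ rev V'"
      using bV' by (simp add: w'_def flip: rev_filter)
    show "count_list w' x \<le> 1" if "x \<notin> set (rev V')" for x
      using notV[of x] that bs bQ bR by (auto simp: w'_def)
    \<comment> \<open>The new last letter comes from \<open>s\<close>, or is \<open>b\<close> if
      \<open>s\<close> is empty. Both are outside \<open>V'\<close>, so the hypothesis on the last
      letter is passed on.\<close>
    have "last w' \<in> set (b # rev s)"
      unfolding w'_def by (metis append_assoc last_appendR last_in_set list.discI)
    then show "last w' \<notin> set (rev V')"
      using bV' w(2) V by auto
  qed (rule adj)
  then show ?case
    using scattered_phi_pow_remdups_adj[of k "phi_aba w"] rem by (simp add: funpow_swap1)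
qed

section \<open>Critical words\<close>

text \<open>The words of length \<open>2 * length U + 3\<close> that one application of the map sends, up to repetitions
  of adjacent letters, to \<open>rev U @ rev U @ [a]\<close>. One letter occurs three times: the leading letter
  \<open>a\<close>, or a letter \<open>t\<close> of \<open>U\<close> that is repeated after or before the second occurrence of \<open>a\<close>.\<close>

definition first_triple :: "'a list \<Rightarrow> 'a \<Rightarrow> 'a list set" where
  "first_triple U a = {a # drop k U @ a # drop i U @ take k U @ a # take i U | i k. k \<le> i \<and> i \<le> length U}"

definition late_triple :: "'a list \<Rightarrow> 'a \<Rightarrow> 'a list set" where
  "late_triple U a = {a # U @ a # S @ t # R @ t # Q | S t R Q. U = S @ t # Q @ R}"

definition early_triple :: "'a list \<Rightarrow> 'a \<Rightarrow> 'a list set" where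
  "early_triple U a = {a # S @ t # R @ t # Q @ a # U | S t R Q. U = S @ t # Q @ R}"

definition critical_words :: "'a list \<Rightarrow> 'a \<Rightarrow> 'a list set" where
  "critical_words U a = first_triple U a \<union> late_triple U a \<union> early_triple U a"

lemma phi_two:
  assumes "a \<notin> set A" "a \<notin> set B"
  shows "phi_aba (a # A @ a # B) = phi_aba A @ phi_aba B @ [a, a]"
  using phi_distinct_prefix_twice[of "[]" a A B] assms by simp

lemma phi_three:
  assumes "a \<notin> set A" "a \<notin> set B" "a \<notin> set C"
  shows "phi_aba (a # A @ a # B @ a # C) = phi_aba A @ phi_aba B @ phi_aba C @ [a, a, a]"
  using phi_Cons_in[OF assms(1), of "B @ a # C"] phi_two[OF assms(2,3)] by simp

text \<open>Up to the doubled \<open>t\<close>, the output is the reverse of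
  \<open>S @ t # Q @ R\<close>; this is why \<open>Q\<close> and \<open>R\<close> change places in
  the late and early triples.\<close>

lemma phi_repeat_block:
  assumes "distinct S" "distinct Q" "distinct R" "t \<notin> set R" "t \<notin> set Q"
    "set S \<inter> set (t # R @ t # Q) = {}"
  shows "phi_aba (S @ t # R @ t # Q) = rev R @ rev Q @ t # t # rev S"
  using phi_distinct_prefix_twice[OF assms(1,6,4,5)] assms(2,3) by (simp add: phi_distinct)

lemma remdups_adj_phi_critical:
  assumes "distinct (a # U)" "2 \<le> length U" "w \<in> critical_words U a"
  shows "remdups_adj (phi_aba w) = rev U @ rev U @ [a]"
proof -
  have a: "a \<notin> set U" and dU: "distinct U"
    using assms(1) by auto
  \<comment> \<open>Where the two copies of \<open>rev U\<close> meet, \<open>hd U\<close> stands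
    next to \<open>last U\<close>; these differ because \<open>U\<close> has at least two
    letters.\<close>
  have "hd U \<noteq> last U"
  proof (cases U)
    case (Cons u U')
    with assms(2) have "U' \<noteq> []" by auto
    with Cons dU last_in_set[of U'] show ?thesis by auto
  qed (use assms(2) in simp)
  moreover have "U \<noteq> []" using assms(2) by auto
  moreover have "a \<noteq> hd U"
    using a \<open>U \<noteq> []\<close> by auto
  moreover have "distinct_adj U"
    using dU by (simp add: distinct_adj_altdef remdups_adj_distinct)
  ultimately have adj: "distinct_adj (rev U @ rev U @ [a])"
    by (auto simp: distinct_adj_append_iff hd_rev last_rev)
  consider "w \<in> first_triple U a" | "w \<in> late_triple U a" | "w \<in> early_triple U a"
    using assms(3) by (auto simp: critical_words_def)
  then have "remdups_adj (phi_aba w) = remdups_adj (rev U @ rev U @ [a])"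
  proof cases
    case 1
    then obtain i k where w: "w = a # drop k U @ a # (drop i U @ take k U) @ a # take i U" and ik: "k \<le> i" "i \<le> length U"
      by (auto simp: first_triple_def)
    \<comment> \<open>The condition \<open>k \<le> i\<close> makes the middle block free of
      repetitions. All three blocks are then just reversed, and taken from last to first they join
      to \<open>U @ U\<close>.\<close>
    have "distinct (drop i U @ take k U)"
      using dU set_take_disj_set_drop_if_distinct[OF dU ik(1)] by auto
    moreover have "a \<notin> set (drop k U)" "a \<notin> set (drop i U @ take k U)" "a \<notin> set (take i U)"
      using a by (auto dest: in_set_dropD in_set_takeD)
    ultimately have "phi_aba w = rev (drop k U) @ rev (drop i U @ take k U) @ rev (take i U) @ [a, a, a]"
      unfolding w using dU by (simp only: phi_three phi_distinct distinct_drop distinct_take not_False_eq_True)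
    also have "\<dots> = rev ((take i U @ drop i U) @ (take k U @ drop k U)) @ [a, a, a]"
      by (simp only: rev_append append_assoc)
    also have "\<dots> = rev U @ rev U @ [a, a, a]"
      by (simp only: append_take_drop_id rev_append append_assoc)
    finally show ?thesis
      using remdups_adj_double[of "rev U @ rev U" a "[a]"] remdups_adj_double[of "rev U @ rev U" a "[]"] by simp
  next
    case 2
    then obtain S t R Q where w: "w = a # U @ a # S @ t # R @ t # Q" and U: "U = S @ t # Q @ R"
      by (auto simp: late_triple_def)
    have na: "a \<notin> set (S @ t # R @ t # Q)"
      using a U by auto
    have "phi_aba w = rev U @ phi_aba (S @ t # R @ t # Q) @ [a, a]"
      unfolding w phi_two[OF a na] phi_distinct[OF dU] ..
    also have "phi_aba (S @ t # R @ t # Q) = rev R @ rev Q @ t # t # rev S"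
      using dU U by (intro phi_repeat_block) auto
    also have "rev U @ (rev R @ rev Q @ t # t # rev S) @ [a, a] = (rev U @ rev R @ rev Q) @ t # t # rev S @ [a, a]"
      by simp
    finally show ?thesis
      using U remdups_adj_double[of "rev U @ rev R @ rev Q" t "rev S @ [a, a]"]
        remdups_adj_double[of "rev U @ rev R @ rev Q @ t # rev S" a "[]"] by simp
  next
    case 3
    then obtain S t R Q where w: "w = a # (S @ t # R @ t # Q) @ a # U" and U: "U = S @ t # Q @ R"
      by (auto simp: early_triple_def)
    have na: "a \<notin> set (S @ t # R @ t # Q)"
      using a U by auto
    have "phi_aba w = phi_aba (S @ t # R @ t # Q) @ rev U @ [a, a]"
      unfolding w phi_two[OF na a] phi_distinct[OF dU] ..
    also have "phi_aba (S @ t # R @ t # Q) = rev R @ rev Q @ t # t # rev S"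
      using dU U by (intro phi_repeat_block) auto
    also have "(rev R @ rev Q @ t # t # rev S) @ rev U @ [a, a] = (rev R @ rev Q) @ t # t # rev S @ rev U @ [a, a]"
      by simp
    finally show ?thesis
      using U remdups_adj_double[of "rev R @ rev Q" t "rev S @ rev U @ [a, a]"]
        remdups_adj_double[of "rev R @ rev Q @ t # rev S @ rev U" a "[]"] by simp
  qed
  with adj show ?thesis
    by (simp add: distinct_adj_altdef)
qed

lemma set_critical:
  assumes "w \<in> critical_words U a"
  shows "set w = insert a (set U)"
proof -
  consider "w \<in> first_triple U a" | "w \<in> late_triple U a" | "w \<in> early_triple U a"
    using assms by (auto simp: critical_words_def)
  then show ?thesis
  proof cases
    case 1
    then obtain i k where w: "w = a # drop k U @ a # drop i U @ take k U @ a # take i U" and ik: "k \<le> i"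
      by (auto simp: first_triple_def)
    have "set U = set (take i U) \<union> set (drop i U)"
      by (metis append_take_drop_id set_append)
    then have "set U = set (take i U) \<union> set (drop k U) \<union> set (drop i U) \<union> set (take k U)"
      using set_drop_subset_set_drop[OF ik, of U] set_drop_subset[of k U] set_take_subset[of k U] by blast
    then show ?thesis
      unfolding w by auto
  qed (auto simp: late_triple_def early_triple_def)
qed

lemma length_critical: "w \<in> critical_words U a \<Longrightarrow> length w = 2 * length U + 3"
  by (auto simp: critical_words_def first_triple_def late_triple_def early_triple_def)

text \<open>One step leads to the square \<open>rev U @ rev U\<close> followed by the separating
  letter \<open>a\<close>, in which some letter stays scattered through the remaining
  \<open>length U - 1\<close> steps.\<close>

lemma critical_words_scattered:
  assumes "distinct (a # U)" "2 \<le> length U" "w \<in> critical_words U a"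
  shows "scattered ((phi_aba ^^ length U) w) \<noteq> {}"
proof -
  obtain k where k: "length U = Suc k"
    using assms(2) by (cases "length U") auto
  let ?w' = "rev U @ rev U @ [a]"
  note rem = remdups_adj_phi_critical[OF assms]
  have "scattered ((phi_aba ^^ k) ?w') \<noteq> {}"
  proof (rule scattered_phi_pow_double_word)
    show "distinct_adj ?w'"
      using rem distinct_adj_remdups_adj by metis
    show "count_list ?w' x \<le> 1" if "x \<notin> set (rev U)" for x
      using that by simp
  qed (use assms(1) k in \<open>auto simp flip: rev_filter\<close>)
  then show ?thesis
    using scattered_phi_pow_remdups_adj[of k "phi_aba w"] rem k by (simp add: funpow_swap1)
qed

section \<open>Every word that stays unsorted long enough is critical\<close>

text \<open>Here \<open>D\<close> is the other block of the word. The first repeated letter of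
  \<open>C\<close> becomes contiguous in the image of \<open>C\<close>, so by \<open>sc\<close> it
  has a further copy in \<open>D\<close> and must be the triple letter \<open>t\<close>. A
  repetition inside \<open>R\<close> or \<open>Q\<close> would give a contiguous letter without
  copies in \<open>D\<close>.\<close>

lemma triple_block:
  assumes "\<not> distinct C"
    and cnt: "\<And>x. count_list C x + count_list D x \<le> (if x = t then 3 else 2)"
    and sc: "\<And>x. 2 \<le> count_list C x \<Longrightarrow> x \<notin> set D \<Longrightarrow> x \<in> scattered (phi_aba C)"
  obtains S R Q where "C = S @ t # R @ t # Q" "distinct S" "distinct Q" "distinct R"
    "t \<notin> set R" "t \<notin> set Q" "set S \<inter> set (t # R @ t # Q) = {}" "t \<in> set D"
proof -
  obtain S y z where C: "C = S @ y # z" "y \<in> set z" "distinct S" "set S \<inter> set (y # z) = {}"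
    using first_repeated_split[OF assms(1)] .
  have "2 \<le> count_list C y"
    using C(1,2) count_list_0_iff[of z y] by simp
  moreover have y: "y \<in> set D"
    using sc[OF calculation] first_repeated_not_scattered[OF C(3,4)] C(1) by blast
  ultimately have yt: "y = t" and Dt: "0 < count_list D t"
    using cnt[of y] count_list_0_iff[of D y] by (auto split: if_splits)
  from C(2) obtain R Q where z: "z = R @ t # Q" "t \<notin> set R"
    unfolding yt by (meson split_list_first)
  have C': "C = S @ t # R @ t # Q"
    using C(1) z yt by simp
  then have tQ: "t \<notin> set Q"
    using cnt[of t] Dt by (simp add: count_list_0_iff[symmetric])
  have disj: "set S \<inter> set (t # R @ t # Q) = {}"
    using C(4) z yt by simp
  have phi: "phi_aba C = (phi_aba R @ phi_aba Q) @ t # t # rev S"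
    unfolding C' by (rule phi_distinct_prefix_twice[OF C(3) disj z(2) tQ])
  have "distinct R"
  proof (rule ccontr)
    assume "\<not> distinct R"
    then obtain x where x: "2 \<le> count_list R x" "x \<notin> scattered (phi_aba R)"
      using exists_repeated_not_scattered[of R] by metis
    have xt: "x \<noteq> t"
      using x(1) z(2) by auto
    have zero: "count_list Q x = 0" "count_list S x = 0" "count_list D x = 0"
      using cnt[of x] x(1) xt by (simp_all add: C')
    then have "x \<notin> set (phi_aba Q @ t # t # rev S)"
      using xt by (simp add: count_list_0_iff)
    with x(2) have "x \<notin> scattered (phi_aba C)"
      using phi scattered_append_right[of x "phi_aba Q @ t # t # rev S" "phi_aba R"] by simp
    with sc[of x] x(1) zero(3) show False
      by (simp add: C' count_list_0_iff)
  qed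
  moreover have "distinct Q"
  proof (rule ccontr)
    assume "\<not> distinct Q"
    then obtain x where x: "2 \<le> count_list Q x" "x \<notin> scattered (phi_aba Q)"
      using exists_repeated_not_scattered[of Q] by metis
    have xt: "x \<noteq> t"
      using x(1) tQ by auto
    have zero: "count_list R x = 0" "count_list S x = 0" "count_list D x = 0"
      using cnt[of x] x(1) xt by (simp_all add: C')
    then have "x \<notin> set (phi_aba R)" "x \<notin> set (t # t # rev S)"
      using xt by (simp_all add: count_list_0_iff)
    with x(2) have "x \<notin> scattered (phi_aba C)"
      using phi not_scattered_append[of x "phi_aba R" "t # t # rev S" "phi_aba Q"] by simp
    with sc[of x] x(1) zero(3) show False
      by (simp add: C' count_list_0_iff)
  qed
  ultimately show thesis
    using that C' C(3) z(2) tQ disj y yt by blast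
qed

text \<open>In \<open>v @ [a]\<close> exactly the letters of \<open>v\<close> are scattered, so the
  square found among the scattered letters is all of \<open>v\<close>.\<close>

lemma double_word_squareE:
  assumes rem: "remdups_adj (phi_aba w) = remdups_adj (v @ [a])" and "a \<notin> set v"
    and cnt: "\<And>x. x \<in> set v \<Longrightarrow> count_list v x = 2"
    and sc: "set v \<subseteq> scattered (phi_aba w)"
    and "card (set v) = Suc k" "scattered ((phi_aba ^^ k) (phi_aba w)) \<noteq> {}"
  obtains V where "v = V @ V" "distinct V" "length V = Suc k"
proof -
  have sc_v: "set v \<subseteq> scattered v"
  proof
    fix x assume "x \<in> set v"
    with sc have "x \<in> scattered (v @ [a])"
      using scattered_remdups_adj[of "phi_aba w"] scattered_remdups_adj[of "v @ [a]"] rem by auto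
    then show "x \<in> scattered v"
      using \<open>x \<in> set v\<close> \<open>a \<notin> set v\<close> scattered_append_right[of x "[a]" v] by auto
  qed
  have "distinct_adj v"
  proof (rule distinct_adjI_scattered)
    show "count_list v x \<le> 2" for x
      using cnt[of x] by (cases "x \<in> set v") auto
    show "x \<in> scattered v" if "count_list v x = 2" for x
      using that sc_v count_list_0_iff[of v x] by auto
  qed
  then have adj: "distinct_adj (v @ [a])"
    using \<open>a \<notin> set v\<close> last_in_set[of v] by (auto simp: distinct_adj_append_iff)
  have sc_va: "scattered (v @ [a]) = set v"
  proof (intro equalityI subsetI)
    fix x assume x: "x \<in> scattered (v @ [a])"
    then have "2 \<le> count_list (v @ [a]) x"
      using scattered_distinct_adj[OF adj] by simp
    then show "x \<in> set v"
      using count_list_0_iff[of v x] by (auto split: if_splits)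
  next
    fix x assume "x \<in> set v"
    then show "x \<in> scattered (v @ [a])"
      using scattered_distinct_adj[OF adj, of x] cnt[of x] by auto
  qed
  have "\<exists>V. filter (\<lambda>x. x \<in> scattered (v @ [a])) (v @ [a]) = V @ V"
  proof (rule scattered_double_word[OF adj])
    show "count_list (v @ [a]) x = 2" if "x \<in> scattered (v @ [a])" for x
      using that cnt[of x] \<open>a \<notin> set v\<close> unfolding sc_va by auto
    show "card (scattered (v @ [a])) = Suc k"
      using assms(5) sc_va by simp
    show "scattered ((phi_aba ^^ k) (v @ [a])) \<noteq> {}"
      using assms(6) scattered_phi_pow_remdups_adj[of k "phi_aba w"] scattered_phi_pow_remdups_adj[of k "v @ [a]"] rem
      by simp
  qed
  then obtain V where "filter (\<lambda>x. x \<in> scattered (v @ [a])) (v @ [a]) = V @ V"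
    by blast
  then have V: "v = V @ V"
    using \<open>a \<notin> set v\<close> unfolding sc_va by simp
  have "distinct V"
  proof (rule distinctI_count_list)
    show "count_list V x \<le> 1" for x
      using cnt[of x] V by (cases "x \<in> set v") auto
  qed
  moreover have "length V = Suc k"
    using distinct_card[OF calculation] assms(5) V by simp
  ultimately show thesis
    using that V by blast
qed

lemma count_list_mem: "2 \<le> count_list w x \<Longrightarrow> x \<in> set w"
  by (rule ccontr) simp

text \<open>The occurrences in excess of two per letter sum to \<open>1\<close>, so a single letter
  carries the whole excess.\<close>

lemma length_excess_one:
  assumes "\<And>x. x \<in> set w \<Longrightarrow> 2 \<le> count_list w x" "length w = 2 * card (set w) + 1"
  obtains t where "t \<in> set w" "count_list w t = 3" "\<And>x. x \<in> set w \<Longrightarrow> x \<noteq> t \<Longrightarrow> count_list w x = 2"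
proof -
  have "(\<Sum>x\<in>set w. count_list w x - 2) = (\<Sum>x\<in>set w. count_list w x) - (\<Sum>x\<in>set w. 2)"
    using assms(1) by (intro sum_subtractf_nat)
  also have "\<dots> = 1"
    using assms(2) sum_count_set[of w "set w"] by simp
  finally obtain t where t: "t \<in> set w" "count_list w t - 2 = 1"
    "\<forall>x\<in>set w. t \<noteq> x \<longrightarrow> count_list w x - 2 = 0"
    by (auto simp: sum_eq_Suc0_iff)
  show thesis
  proof (rule that[of t])
    show "count_list w x = 2" if "x \<in> set w" "x \<noteq> t" for x
      using that t(3) assms(1)[of x] by (metis diff_is_0_eq le_antisym)
  qed (use t in auto)
qed

text \<open>By length, \<open>Z\<close> is a prefix of the first copy of \<open>U\<close> and
  \<open>X\<close> a suffix of the second, and \<open>Y\<close> is what remains. The bound on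
  \<open>Y\<close> amounts to \<open>k \<le> i\<close>.\<close>

lemma square_cut:
  assumes "Z @ Y @ X = U @ U" "length X \<le> length U" "length Y \<le> length U" "length Z \<le> length U"
  shows "\<exists>i k. k \<le> i \<and> i \<le> length U \<and> X = drop k U \<and> Y = drop i U @ take k U \<and> Z = take i U"
proof -
  define i where "i = length Z"
  define k where "k = length U - length X"
  have len: "length Z + length Y + length X = 2 * length U"
    using arg_cong[OF assms(1), of length] by simp
  then have ki: "k \<le> i" "i \<le> length U"
    using assms(3,4) by (auto simp: i_def k_def)
  have "Z = take i (U @ U)"
    unfolding assms(1)[symmetric] by (simp add: i_def)
  then have Z: "Z = take i U"
    using ki by simp
  have "X = drop (length U + k) (U @ U)"
    unfolding assms(1)[symmetric] using len assms(2) by (simp add: k_def)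
  then have X: "X = drop k U"
    by simp
  have "take i U @ Y @ drop k U = take i U @ (drop i U @ take k U) @ drop k U"
    using assms(1) unfolding Z X by (metis append.assoc append_take_drop_id)
  then have "Y = drop i U @ take k U"
    by (simp only: same_append_eq append_same_eq)
  with ki X Z show ?thesis by blast
qed

text \<open>If the first letter \<open>a\<close> is the triple letter, its copies delimit three
  blocks that cut a square at two places. Otherwise \<open>a\<close> delimits two blocks, the triple
  letter is repeated in one of them, and the other is the reverse of one half of the square.\<close>

lemma critical_words_complete:
  fixes w :: "'a list"
  assumes len: "length w = 2 * card (set w) + 1" and card: "card (set w) = Suc (Suc k)"
    and sc: "scattered ((phi_aba ^^ Suc k) w) \<noteq> {}"
  shows "\<exists>U a. distinct (a # U) \<and> length U = Suc k \<and> w \<in> critical_words U a"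
proof -
  have "card (scattered ((phi_aba ^^ Suc k) w)) \<noteq> 0"
    using sc by simp
  \<comment> \<open>Each of the \<open>Suc k\<close> steps loses a scattered letter and one is left,
    so all \<open>k + 2\<close> letters are scattered at the start.\<close>
  then have "card (set w) \<le> card (scattered w)"
    using card_scattered_phi_pow[OF sc] card by linarith
  then have sc_w: "scattered w = set w"
    using card_seteq[OF finite_set scattered_subset] by blast
  then have card_sc: "card (scattered w) = Suc (Suc k)"
    using card by simp
  note crit = scattered_critical[OF card_sc sc]
  obtain a w1 where aw1: "w = a # w1"
    using card by (cases w) auto
  then have aw: "a \<in> set w"
    by simp
  have other: "x \<in> scattered (phi_aba w)" if "x \<in> set w" "x \<noteq> a" for x
    using that crit(3)[of x a] hd_not_scattered_phi[of a w1] sc_w aw1 by auto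
  obtain t where t: "t \<in> set w" "count_list w t = 3"
    and two: "\<And>x. x \<in> set w \<Longrightarrow> x \<noteq> t \<Longrightarrow> count_list w x = 2"
    using length_excess_one[OF _ len] count_scattered sc_w by metis
  \<comment> \<open>In every case below the image collapses to some \<open>v @ [a]\<close> in which
    each letter other than \<open>a\<close> occurs twice.\<close>
  have square: "\<exists>V. v = V @ V \<and> distinct V \<and> length V = Suc k \<and> set V = set w - {a}"
    if rem: "remdups_adj (phi_aba w) = remdups_adj (v @ [a])"
      and cnt: "\<And>x. count_list v x = (if x \<in> set w \<and> x \<noteq> a then 2 else 0)" for v
  proof -
    have set_v: "set v = set w - {a}"
    proof (intro set_eqI)
      show "x \<in> set v \<longleftrightarrow> x \<in> set w - {a}" for x
        using cnt[of x] count_list_0_iff[of v x] by (auto split: if_splits)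
    qed
    have card_v: "card (set v) = Suc k"
      using set_v card card_Diff_singleton[of a "set w"] aw by simp
    have av: "a \<notin> set v" and sub: "set v \<subseteq> scattered (phi_aba w)"
      using set_v other by auto
    have cnt2: "count_list v x = 2" if "x \<in> set v" for x
      using that cnt[of x] set_v by auto
    obtain V where "v = V @ V" "distinct V" "length V = Suc k"
      using double_word_squareE[OF rem av cnt2 sub card_v crit(2)] .
    with set_v show ?thesis by auto
  qed
  show ?thesis
  proof (cases "t = a")
    case True
    have "count_list w1 a = 2"
      using t(2) aw1 True by simp
    then obtain X w2 where w1: "w1 = X @ a # w2" "a \<notin> set X" "count_list w2 a = 1"
      using count_list_Suc_split_first[of w1 a 1] by auto
    then obtain Y Z where w2: "w2 = Y @ a # Z" "a \<notin> set Y" "count_list Z a = 0"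
      using count_list_Suc_split_first[of w2 a 0] by auto
    then have aZ: "a \<notin> set Z"
      by (simp add: count_list_0_iff)
    have w: "w = a # X @ a # Y @ a # Z"
      using aw1 w1 w2 by simp
    have counts: "count_list X x + count_list Y x + count_list Z x = (if x \<in> set w \<and> x \<noteq> a then 2 else 0)" for x
    proof (cases "x \<in> set w \<and> x \<noteq> a")
      case xw: True
      then have "count_list w x = 2"
        using two[of x] True by auto
      then show ?thesis
        unfolding if_P[OF xw] using conjunct2[OF xw] not_sym by (auto simp: w)
    next
      case False
      then show ?thesis using w1(2) w2(2) aZ w by auto
    qed
    have phi: "phi_aba w = phi_aba X @ phi_aba Y @ phi_aba Z @ [a, a, a]"
      unfolding w using w1(2) w2(2) aZ by (rule phi_three)
    \<comment> \<open>A letter repeated within one block has no copies in the others, so it would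
      become contiguous in the same step as \<open>a\<close>. The contexts \<open>A\<close> and
      \<open>C\<close> let one argument serve all three blocks.\<close>
    have dist: "distinct B"
      if phi: "phi_aba w = A @ phi_aba B @ C"
        and cnt: "\<And>x. x \<noteq> a \<Longrightarrow> count_list A x + count_list B x + count_list C x \<le> 2"
        and aB: "a \<notin> set B" for A B C
    proof (rule ccontr)
      assume "\<not> distinct B"
      then obtain y where y: "2 \<le> count_list B y" "y \<notin> scattered (phi_aba B)"
        using exists_repeated_not_scattered[of B] by metis
      have yB: "y \<in> set B"
        using count_list_mem[OF y(1)] .
      then have ya: "y \<noteq> a"
        using aB by auto
      from yB have "y \<in> set w"
        using set_phi[of w] phi by auto
      moreover have "y \<notin> set A" "y \<notin> set C"
        using cnt[OF ya] y(1) by (simp_all add: count_list_0_iff[symmetric])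
      ultimately show False
        using y(2) other[OF _ ya] phi not_scattered_append[of y A C "phi_aba B"] by simp
    qed
    have cnt_phi: "count_list (phi_aba B) x = count_list B x" for B :: "'a list" and x
      by (induction B rule: phi_induct) (auto simp: phi_Cons_notin phi_Cons_in)
    have dX: "distinct X" and dY: "distinct Y" and dZ: "distinct Z"
      using dist[of "[]" X "phi_aba Y @ phi_aba Z @ [a, a, a]"] dist[of "phi_aba X" Y "phi_aba Z @ [a, a, a]"]
        dist[of "phi_aba X @ phi_aba Y" Z "[a, a, a]"] phi counts w1(2) w2(2) aZ
      by (simp_all add: cnt_phi add.assoc)
    have "remdups_adj (phi_aba w) = remdups_adj ((rev X @ rev Y @ rev Z) @ [a])"
      using remdups_adj_double[of "rev X @ rev Y @ rev Z" a "[a]"] remdups_adj_double[of "rev X @ rev Y @ rev Z" a "[]"]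
      by (simp add: phi phi_distinct dX dY dZ)
    from square[OF this] obtain V where V: "rev X @ rev Y @ rev Z = V @ V" "distinct V" "length V = Suc k" "set V = set w - {a}"
      using counts by (auto simp: add.assoc)
    have "rev (rev X @ rev Y @ rev Z) = rev V @ rev V"
      unfolding V(1) by simp
    then have ZYX: "Z @ Y @ X = rev V @ rev V"
      by simp
    \<comment> \<open>Repetition-free blocks over the letters of \<open>V\<close> are at most as
      long as \<open>V\<close>, which gives the bounds needed to cut the square.\<close>
    have le: "length B \<le> length (rev V)" if "distinct B" "set B \<subseteq> set w - {a}" for B
      using card_mono[of "set V" "set B"] distinct_card[of B] distinct_card[OF V(2)] that V(4) by auto
    have "set X \<subseteq> set w - {a}" "set Y \<subseteq> set w - {a}" "set Z \<subseteq> set w - {a}"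
      using w w1(2) w2(2) aZ by auto
    then obtain i k' where "k' \<le> i" "i \<le> length (rev V)" "X = drop k' (rev V)"
      "Y = drop i (rev V) @ take k' (rev V)" "Z = take i (rev V)"
      using square_cut[OF ZYX] le dX dY dZ by blast
    then have "w \<in> first_triple (rev V) a"
      unfolding first_triple_def w by auto
    then show ?thesis
      using V by (intro exI[of _ "rev V"] exI[of _ a]) (auto simp: critical_words_def)
  next
    case False
    have "count_list w1 a = 1"
      using two[of a] aw1 False by simp
    then obtain A B where w1: "w1 = A @ a # B" "a \<notin> set A" "count_list B a = 0"
      using count_list_Suc_split_first[of w1 a 0] by auto
    then have aA: "a \<notin> set A" and aB: "a \<notin> set B"
      by (auto simp: count_list_0_iff)
    have w: "w = a # A @ a # B"
      using aw1 w1 by simp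
    have counts: "count_list A x + count_list B x = (if x \<in> set w \<and> x \<noteq> a then (if x = t then 3 else 2) else 0)" for x
    proof (cases "x \<in> set w \<and> x \<noteq> a")
      case xw: True
      then have "count_list w x = (if x = t then 3 else 2)"
        using two[of x] t(2) by auto
      then show ?thesis
        unfolding if_P[OF xw] using conjunct2[OF xw] not_sym by (auto simp: w)
    next
      case False
      then show ?thesis using aA aB w by auto
    qed
    have phi: "phi_aba w = phi_aba A @ phi_aba B @ [a, a]"
      unfolding w using aA aB by (rule phi_two)
    have sc_A: "x \<in> scattered (phi_aba A)" if "2 \<le> count_list A x" "x \<notin> set B" for x
    proof -
      have "x \<in> set A"
        using count_list_mem[OF that(1)] .
      then have "x \<in> scattered (phi_aba w)" "x \<noteq> a"
        using other[of x] w aA by auto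
      then show ?thesis
        using phi that(2) scattered_append_right[of x "phi_aba B @ [a, a]" "phi_aba A"] by simp
    qed
    have sc_B: "x \<in> scattered (phi_aba B)" if "2 \<le> count_list B x" "x \<notin> set A" for x
    proof -
      have "x \<in> set B"
        using count_list_mem[OF that(1)] .
      then have "x \<in> scattered (phi_aba w)" "x \<noteq> a"
        using other[of x] w aB by auto
      then show ?thesis
        using phi that(2) not_scattered_append[of x "phi_aba A" "[a, a]" "phi_aba B"] by auto
    qed
    have t_counts: "count_list A t + count_list B t = 3"
      using counts[of t] t(1) False by simp
    show ?thesis
    proof (cases "distinct A")
      case dA: True
      have "\<not> distinct B"
        using distinct_count_list_le[OF dA, of t] distinct_count_list_le[of B t] t_counts by linarith
      moreover have "count_list B x + count_list A x \<le> (if x = t then 3 else 2)" for x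
        using counts[of x] by (auto split: if_splits)
      ultimately obtain S R Q where B: "B = S @ t # R @ t # Q" and dist: "distinct S" "distinct Q" "distinct R"
        and tRQ: "t \<notin> set R" "t \<notin> set Q" and disj: "set S \<inter> set (t # R @ t # Q) = {}" and tA: "t \<in> set A"
        using triple_block[of B A t] sc_B by metis
      define W where "W = rev R @ rev Q @ t # rev S"
      have "phi_aba w = (rev A @ rev R @ rev Q) @ t # t # rev S @ [a, a]"
        unfolding phi B phi_repeat_block[OF dist tRQ disj] phi_distinct[OF dA] by simp
      then have "remdups_adj (phi_aba w) = remdups_adj ((rev A @ W) @ [a])"
        using remdups_adj_double[of "rev A @ rev R @ rev Q" t "rev S @ [a, a]"]
          remdups_adj_double[of "rev A @ rev R @ rev Q @ t # rev S" a "[]"]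
        by (simp add: W_def)
      moreover have "count_list (rev A @ W) x = (if x \<in> set w \<and> x \<noteq> a then 2 else 0)" for x
        using counts[of x] t(1) False by (auto simp: W_def B split: if_splits)
      ultimately obtain V where V: "rev A @ W = V @ V" "distinct V" "length V = Suc k" "set V = set w - {a}"
        using square by blast
      have "length A \<le> length V"
        using card_mono[of "set V" "set A"] distinct_card[OF dA] distinct_card[OF V(2)] V(4) w aA by auto
      then have "rev A = take (length A) V" "W = drop (length A) V @ V"
        using V(1) by (simp_all add: append_eq_append_conv_if)
      then obtain V2 where V2: "V = rev A @ V2" "W = V2 @ V"
        by (metis append_take_drop_id)
      \<comment> \<open>The last letter of \<open>W\<close> is the first letter of \<open>B\<close>,
        which also occurs in \<open>A\<close>. Since \<open>W\<close> ends with \<open>V\<close>, a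
        nonempty \<open>V2\<close> would end in this letter and share it with \<open>rev A\<close>,
        although \<open>V = rev A @ V2\<close> is distinct.\<close>
      have "V2 = []"
      proof (rule ccontr)
        assume ne: "V2 \<noteq> []"
        have "last W = hd (S @ [t])"
          by (cases S) (auto simp: W_def)
        moreover have "hd (S @ [t]) \<in> set A"
        proof (cases S)
          case (Cons x S')
          then have "count_list B x = 1" "x \<noteq> t" "x \<noteq> a" "x \<in> set w"
            using dist(1) disj aB B w by auto
          then have "count_list A x = 1"
            using counts[of x] by simp
          then show ?thesis
            using Cons count_list_0_iff[of A x] by auto
        qed (use tA in simp)
        moreover have "last W = last V2"
          using V2 ne by simp
        ultimately have "last V2 \<in> set A" "last V2 \<in> set V2"
          using last_in_set[OF ne] by auto
        with V(2) V2(1) show False by auto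
      qed
      then have "rev (rev A) = rev W"
        using V2 by simp
      then have "A = S @ t # Q @ R"
        by (simp add: W_def)
      then have "w \<in> late_triple A a"
        unfolding late_triple_def w B by blast
      moreover have "length A = Suc k"
        using V2 V(3) \<open>V2 = []\<close> by simp
      ultimately show ?thesis
        using aA dA by (intro exI[of _ A] exI[of _ a]) (auto simp: critical_words_def)
    next
      case ndA: False
      have "count_list A x + count_list B x \<le> (if x = t then 3 else 2)" for x
        using counts[of x] by (auto split: if_splits)
      with ndA obtain S R Q where A: "A = S @ t # R @ t # Q" and dist: "distinct S" "distinct Q" "distinct R"
        and tRQ: "t \<notin> set R" "t \<notin> set Q" and disj: "set S \<inter> set (t # R @ t # Q) = {}" and tB: "t \<in> set B"
        using triple_block[of A B t] sc_A by metis
      \<comment> \<open>The two copies of \<open>t\<close> in \<open>A\<close> leave only one for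
        \<open>B\<close>. Any other letter repeated in \<open>B\<close> is absent from
        \<open>A\<close> and would have to stay scattered in the image of \<open>B\<close>.\<close>
      have dB: "distinct B"
      proof (rule ccontr)
        assume "\<not> distinct B"
        then obtain y where y: "2 \<le> count_list B y" "y \<notin> scattered (phi_aba B)"
          using exists_repeated_not_scattered[of B] by metis
        have "y \<noteq> t"
          using y(1) t_counts A by auto
        then have "count_list A y = 0"
          using y(1) counts[of y] by (simp split: if_splits)
        with y sc_B[of y] show False
          by (simp add: count_list_0_iff)
      qed
      define W where "W = rev R @ rev Q @ t # rev S"
      have "phi_aba w = (rev R @ rev Q) @ t # t # rev S @ rev B @ [a, a]"
        unfolding phi A phi_repeat_block[OF dist tRQ disj] phi_distinct[OF dB] by simp
      then have "remdups_adj (phi_aba w) = remdups_adj ((W @ rev B) @ [a])"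
        using remdups_adj_double[of "rev R @ rev Q" t "rev S @ rev B @ [a, a]"]
          remdups_adj_double[of "rev R @ rev Q @ t # rev S @ rev B" a "[]"]
        by (simp add: W_def)
      moreover have "count_list (W @ rev B) x = (if x \<in> set w \<and> x \<noteq> a then 2 else 0)" for x
        using counts[of x] t(1) False by (auto simp: W_def A split: if_splits)
      ultimately obtain V where V: "W @ rev B = V @ V" "distinct V" "length V = Suc k" "set V = set w - {a}"
        using square by blast
      have "length B \<le> length V"
        using card_mono[of "set V" "set B"] distinct_card[OF dB] distinct_card[OF V(2)] V(4) w aB by auto
      moreover have "length W + length B = length V + length V"
        using arg_cong[OF V(1), of length] by simp
      ultimately have "V = take (length V) W" "V = drop (length V) W @ rev B"
        using V(1)[symmetric] by (simp_all add: append_eq_append_conv_if)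
      then obtain V1 where V1: "V = V1 @ rev B" "W = V @ V1"
        by (metis append_take_drop_id)
      \<comment> \<open>As in the previous case: \<open>W\<close> ends in \<open>V1\<close>, so a
        nonempty \<open>V1\<close> would end in the first letter of \<open>A\<close>, which also
        occurs in \<open>B\<close>, although \<open>V = V1 @ rev B\<close> is distinct.\<close>
      have "V1 = []"
      proof (rule ccontr)
        assume ne: "V1 \<noteq> []"
        have "last W = hd (S @ [t])"
          by (cases S) (auto simp: W_def)
        moreover have "hd (S @ [t]) \<in> set B"
        proof (cases S)
          case (Cons x S')
          then have "count_list A x = 1" "x \<noteq> t" "x \<noteq> a" "x \<in> set w"
            using dist(1) disj aA A w by auto
          then have "count_list B x = 1"
            using counts[of x] by simp
          then show ?thesis
            using Cons count_list_0_iff[of B x] by auto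
        qed (use tB in simp)
        moreover have "last W = last V1"
          using V1 ne by simp
        ultimately have "last V1 \<in> set B" "last V1 \<in> set V1"
          using last_in_set[OF ne] by auto
        with V(2) V1(1) show False by auto
      qed
      then have "rev W = B"
        using V1 by simp
      then have "B = S @ t # Q @ R"
        by (simp add: W_def)
      then have "w \<in> early_triple B a"
        unfolding early_triple_def w A by auto
      moreover have "length B = Suc k"
        using V1 V(3) \<open>V1 = []\<close> by simp
      ultimately show ?thesis
        using aB dB by (intro exI[of _ B] exI[of _ a]) (auto simp: critical_words_def)
    qed
  qed
qed

section \<open>Counting\<close>

lemma card_triangle: "card (SIGMA i:{..n}. {..i}) = Suc (Suc n) choose 2" for n :: nat
proof -
  have "card (SIGMA i:{..n}. {..i}) = (\<Sum>i\<le>n. Suc i)"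
    by simp
  also have "\<dots> = Suc (Suc n) choose 2"
    by (induction n) (simp_all add: numeral_2_eq_2)
  finally show ?thesis .
qed

lemma card_strict_triangle: "card (SIGMA i:{..n}. {..<i}) = Suc n choose 2" for n :: nat
proof -
  have "card (SIGMA i:{..n}. {..<i}) = (\<Sum>i\<le>n. i)"
    by simp
  also have "\<dots> = Suc n choose 2"
    by (induction n) (simp_all add: numeral_2_eq_2)
  finally show ?thesis .
qed

lemma append_Cons_first_eq:
  assumes "xs @ x # ys = xs' @ x # ys'" "x \<notin> set xs" "x \<notin> set xs'"
  shows "xs = xs' \<and> ys = ys'"
  using assms
proof (induction xs arbitrary: xs')
  case Nil
  then show ?case by (cases xs') auto
next
  case (Cons z xs)
  then show ?case by (cases xs') auto
qed

text \<open>As \<open>a\<close> is not in \<open>U\<close>, its three occurrences mark the blocks.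
  The first block \<open>drop k U\<close> determines \<open>k\<close> and the last block
  \<open>take i U\<close> determines \<open>i\<close>, so the count is that of the pairs
  \<open>k \<le> i \<le> length U\<close>.\<close>

lemma card_first_triple:
  assumes "a \<notin> set U"
  shows "finite (first_triple U a)" "card (first_triple U a) = length U + 2 choose 2"
proof -
  let ?I = "SIGMA i:{..length U}. {..i}"
  let ?g = "\<lambda>(i, k). a # drop k U @ a # (drop i U @ take k U) @ a # take i U"
  have image: "first_triple U a = ?g ` ?I"
    by (auto simp: first_triple_def)
  show "finite (first_triple U a)"
    unfolding image by (intro finite_imageI finite_SigmaI) auto
  have "inj_on ?g ?I"
  proof (rule inj_onI)
    fix p q
    assume pq: "p \<in> ?I" "q \<in> ?I" "?g p = ?g q"
    obtain i k i' k' where ik: "p = (i, k)" "q = (i', k')"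
      by (cases p; cases q) auto
    have le: "i \<le> length U" "k \<le> i" "i' \<le> length U" "k' \<le> i'"
      and eq: "a # drop k U @ a # (drop i U @ take k U) @ a # take i U
        = a # drop k' U @ a # (drop i' U @ take k' U) @ a # take i' U"
      using pq ik by simp_all
    have notin: "a \<notin> set (drop j U)" "a \<notin> set (take j U)" for j
      using assms by (auto dest: in_set_dropD in_set_takeD)
    have dr: "drop k U = drop k' U" and tk: "(drop i U @ take k U) @ a # take i U = (drop i' U @ take k' U) @ a # take i' U"
      using eq append_Cons_first_eq[OF _ notin(1)[of k] notin(1)[of k']] by simp_all
    have "take i U = take i' U"
      using append_Cons_first_eq[OF tk] notin by simp
    with dr have "length (drop k U) = length (drop k' U)" "length (take i U) = length (take i' U)"
      by simp_all
    with le ik show "p = q"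
      by simp
  qed
  then have "card (first_triple U a) = card ?I"
    unfolding image by (rule card_image)
  then show "card (first_triple U a) = length U + 2 choose 2"
    using card_triangle[of "length U"] by simp
qed

text \<open>The components are listed in the order in which they appear in
  \<open>S @ t # R @ t # Q\<close>, the block common to late and early triples.\<close>

definition splits :: "'a list \<Rightarrow> ('a list \<times> 'a \<times> 'a list \<times> 'a list) set" where
  "splits U = {(S, t, R, Q). U = S @ t # Q @ R}"

lemma card_splits: "finite (splits U)" "card (splits U) = length U + 1 choose 2"
proof -
  let ?I = "SIGMA i:{..length U}. {..<i}"
  \<comment> \<open>The index \<open>s\<close> is the position of \<open>t\<close> in
    \<open>U\<close>, and \<open>i\<close> is the position at which \<open>R\<close> starts.\<close>
  let ?g = "\<lambda>(i, s). (take s U, U ! s, drop i U, take (i - Suc s) (drop (Suc s) U))"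
  have image: "splits U = ?g ` ?I"
  proof (intro equalityI subsetI)
    fix p assume "p \<in> splits U"
    then obtain S t R Q where p: "p = (S, t, R, Q)" "U = S @ t # Q @ R"
      by (auto simp: splits_def)
    then have "p = ?g (Suc (length S + length Q), length S)"
      by simp
    moreover have "(Suc (length S + length Q), length S) \<in> ?I"
      using p by simp
    ultimately show "p \<in> ?g ` ?I" by (rule image_eqI)
  next
    fix p assume "p \<in> ?g ` ?I"
    then obtain i s where p: "p = ?g (i, s)" and si: "s < i" "i \<le> length U"
      by auto
    have "drop i U = drop (i - Suc s) (drop (Suc s) U)"
      using si by simp
    then have "take (i - Suc s) (drop (Suc s) U) @ drop i U = drop (Suc s) U"
      by (metis append_take_drop_id)
    then show "p \<in> splits U"
      using id_take_nth_drop[of s U] si by (simp add: p splits_def)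
  qed
  show "finite (splits U)"
    unfolding image by (intro finite_imageI finite_SigmaI) auto
  have "inj_on ?g ?I"
  proof (rule inj_onI)
    fix p q
    assume pq: "p \<in> ?I" "q \<in> ?I" "?g p = ?g q"
    obtain i s i' s' where ps: "p = (i, s)" "q = (i', s')"
      by (cases p; cases q) auto
    have le: "i \<le> length U" "s < i" "i' \<le> length U" "s' < i'"
      and eq: "take s U = take s' U" "drop i U = drop i' U"
      using pq ps by simp_all
    show "p = q"
      using arg_cong[OF eq(1), of length] arg_cong[OF eq(2), of length] le ps by simp
  qed
  then have "card (splits U) = card ?I"
    unfolding image by (rule card_image)
  then show "card (splits U) = length U + 1 choose 2"
    using card_strict_triangle[of "length U"] by simp
qed

text \<open>The letter \<open>t\<close> is recovered as the only one with two occurrences, and these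
  occurrences delimit \<open>S\<close>, \<open>R\<close> and \<open>Q\<close>.\<close>

lemma inj_on_splits:
  assumes "distinct U"
  shows "inj_on (\<lambda>(S, t, R, Q). S @ t # R @ t # Q) (splits U)"
proof (rule inj_onI)
  fix p q
  assume pq: "p \<in> splits U" "q \<in> splits U"
    "(\<lambda>(S, t, R, Q). S @ t # R @ t # Q) p = (\<lambda>(S, t, R, Q). S @ t # R @ t # Q) q"
  obtain S t R Q S' t' R' Q' where tup: "p = (S, t, R, Q)" "q = (S', t', R', Q')"
    by (cases p; cases q) auto
  have U: "U = S @ t # Q @ R" "U = S' @ t' # Q' @ R'"
    and eq: "S @ t # R @ t # Q = S' @ t' # R' @ t' # Q'"
    using pq tup by (simp_all add: splits_def)
  have t: "t \<notin> set S" "t \<notin> set R" "t \<notin> set Q" and t': "t' \<notin> set S'" "t' \<notin> set R'" "t' \<notin> set Q'"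
    using assms U(1) assms[unfolded U(2)] by auto
  have "count_list (S' @ t' # R' @ t' # Q') t = count_list U t + (if t = t' then 1 else 0)"
    using U(2) by simp
  moreover have "count_list (S @ t # R @ t # Q) t = 2"
    using t by simp
  ultimately have tt: "t' = t"
    using eq distinct_count_list_le[OF assms, of t] by (auto split: if_splits)
  have "S = S' \<and> R @ t # Q = R' @ t # Q'"
    using append_Cons_first_eq[OF eq[unfolded tt]] t t' tt by simp
  then show "p = q"
    using t t' tup by (simp add: tt append_Cons_eq_iff)
qed

lemma card_late_triple:
  assumes "distinct U"
  shows "finite (late_triple U a)" "card (late_triple U a) = length U + 1 choose 2"
proof -
  let ?g = "\<lambda>(S, t, R, Q). S @ t # R @ t # Q"
  have image: "late_triple U a = (\<lambda>p. a # U @ a # ?g p) ` splits U" (is "_ = ?h ` _")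
  proof (intro equalityI subsetI)
    fix w assume "w \<in> late_triple U a"
    then obtain S t R Q where "w = a # U @ a # S @ t # R @ t # Q" "(S, t, R, Q) \<in> splits U"
      unfolding late_triple_def splits_def by blast
    then show "w \<in> ?h ` splits U"
      by (intro image_eqI[of _ _ "(S, t, R, Q)"]) simp_all
  qed (auto simp: late_triple_def splits_def)
  have "inj_on (\<lambda>p. a # U @ a # ?g p) (splits U)"
    using inj_on_splits[OF assms] by (auto simp: inj_on_def)
  with card_splits[of U] show "finite (late_triple U a)" "card (late_triple U a) = length U + 1 choose 2"
    unfolding image by (simp_all add: card_image)
qed

lemma card_early_triple:
  assumes "distinct U"
  shows "finite (early_triple U a)" "card (early_triple U a) = length U + 1 choose 2"
proof -
  let ?g = "\<lambda>(S, t, R, Q). S @ t # R @ t # Q"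
  have image: "early_triple U a = (\<lambda>p. a # ?g p @ a # U) ` splits U" (is "_ = ?h ` _")
  proof (intro equalityI subsetI)
    fix w assume "w \<in> early_triple U a"
    then obtain S t R Q where "w = a # S @ t # R @ t # Q @ a # U" "(S, t, R, Q) \<in> splits U"
      unfolding early_triple_def splits_def by blast
    then show "w \<in> ?h ` splits U"
      by (intro image_eqI[of _ _ "(S, t, R, Q)"]) simp_all
  next
    fix w assume "w \<in> ?h ` splits U"
    then obtain S t R Q where "w = a # S @ t # R @ t # Q @ a # U" "U = S @ t # Q @ R"
      by (auto simp: splits_def)
    then show "w \<in> early_triple U a"
      unfolding early_triple_def by blast
  qed
  have "inj_on (\<lambda>p. a # ?g p @ a # U) (splits U)"
    using inj_on_splits[OF assms] by (auto simp: inj_on_def)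
  with card_splits[of U] show "finite (early_triple U a)" "card (early_triple U a) = length U + 1 choose 2"
    unfolding image by (simp_all add: card_image)
qed

text \<open>The number of copies of \<open>a\<close>, three or two, separates the first family from
  the others. Late and early triples differ in the block between the two copies of \<open>a\<close>,
  whose length is \<open>length U\<close> in the former and \<open>length U + 1\<close> in the
  latter.\<close>

lemma card_critical_words:
  assumes "distinct (a # U)"
  shows "card (critical_words U a) = (length U + 2 choose 2) + 2 * (length U + 1 choose 2)"
proof -
  have a: "a \<notin> set U" and dU: "distinct U"
    using assms by auto
  have "count_list w a = 3" if "w \<in> first_triple U a" for w
    using that a by (auto simp: first_triple_def count_list_0_iff dest: in_set_dropD in_set_takeD)
  moreover have "count_list w a = 2" if "w \<in> late_triple U a \<union> early_triple U a" for w
    using that a by (auto simp: late_triple_def early_triple_def)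
  ultimately have disj: "first_triple U a \<inter> (late_triple U a \<union> early_triple U a) = {}"
    by fastforce
  have disj': "late_triple U a \<inter> early_triple U a = {}"
  proof -
    have False if late: "w \<in> late_triple U a" and early: "w \<in> early_triple U a" for w
    proof -
      obtain B where B: "w = a # U @ a # B"
        using late unfolding late_triple_def by blast
      obtain S t R Q where w: "w = a # (S @ t # R @ t # Q) @ a # U" and U: "U = S @ t # Q @ R"
        using early by (auto simp: early_triple_def)
      have na: "a \<notin> set (S @ t # R @ t # Q)"
        using a U by auto
      have "U @ a # B = (S @ t # R @ t # Q) @ a # U"
        using B w by simp
      from append_Cons_first_eq[OF this a na] have "U = S @ t # R @ t # Q" ..
      then have "length U = length (S @ t # R @ t # Q)" by (rule arg_cong)
      with U show False by simp
    qed
    then show ?thesis by blast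
  qed
  show ?thesis
    unfolding critical_words_def Un_assoc
    using card_Un_disjoint[OF card_first_triple(1)[OF a] _ disj]
      card_Un_disjoint[OF card_late_triple(1)[OF dU] card_early_triple(1)[OF dU] disj']
      card_first_triple[OF a] card_late_triple[OF dU, of a] card_early_triple[OF dU, of a]
    by simp
qed

section \<open>Relabelling and equivalence classes\<close>

lemma critical_words_map:
  assumes "w \<in> critical_words U a"
  shows "map f w \<in> critical_words (map f U) (f a)"
proof -
  consider "w \<in> first_triple U a" | "w \<in> late_triple U a" | "w \<in> early_triple U a"
    using assms by (auto simp: critical_words_def)
  then show ?thesis
  proof cases
    case 1
    then obtain i k where "w = a # drop k U @ a # drop i U @ take k U @ a # take i U" "k \<le> i" "i \<le> length U"
      by (auto simp: first_triple_def)
    then have "map f w \<in> first_triple (map f U) (f a)"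
      unfolding first_triple_def by (auto simp: drop_map take_map)
    then show ?thesis by (simp add: critical_words_def)
  next
    case 2
    then obtain S t R Q where w: "w = a # U @ a # S @ t # R @ t # Q" "U = S @ t # Q @ R"
      by (auto simp: late_triple_def)
    have "map f w = f a # map f U @ f a # map f S @ f t # map f R @ f t # map f Q"
      "map f U = map f S @ f t # map f Q @ map f R"
      using w by simp_all
    then have "map f w \<in> late_triple (map f U) (f a)"
      unfolding late_triple_def by (intro CollectI exI conjI)
    then show ?thesis by (simp add: critical_words_def)
  next
    case 3
    then obtain S t R Q where w: "w = a # S @ t # R @ t # Q @ a # U" "U = S @ t # Q @ R"
      by (auto simp: early_triple_def)
    have "map f w = f a # map f S @ f t # map f R @ f t # map f Q @ f a # map f U"
      "map f U = map f S @ f t # map f Q @ map f R"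
      using w by simp_all
    then have "map f w \<in> early_triple (map f U) (f a)"
      unfolding early_triple_def by (intro CollectI exI conjI)
    then show ?thesis by (simp add: critical_words_def)
  qed
qed

text \<open>Composing with the transposition of \<open>f x\<close> and \<open>y\<close> corrects the
  value at \<open>x\<close>. It keeps the values on \<open>xs\<close>, which differ from
  \<open>f x\<close> by injectivity and from \<open>y\<close> by distinctness.\<close>

lemma bij_extending_distinct_lists:
  fixes xs ys :: "'a list"
  assumes "length xs = length ys" "distinct xs" "distinct ys"
  shows "\<exists>f. bij f \<and> map f xs = ys"
  using assms
proof (induction xs ys rule: list_induct2)
  case Nil
  show ?case by (auto intro: exI[of _ id])
next
  case (Cons x xs y ys)
  then obtain f where f: "bij f" "map f xs = ys"
    by auto
  let ?g = "transpose (f x) y \<circ> f"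
  have "?g z = f z" if "z \<in> set xs" for z
  proof -
    have "f z \<noteq> f x"
      using that Cons.prems(1) f(1) by (auto dest: bij_is_inj simp: inj_eq)
    moreover have "f z \<noteq> y"
      using that Cons.prems(2) f(2) by auto
    ultimately show ?thesis by simp
  qed
  then have "map ?g (x # xs) = y # ys"
    using f(2) by auto
  moreover have "bij ?g"
    using f(1) by (simp add: bij_comp)
  ultimately show ?case by (intro exI[of _ ?g] conjI)
qed

lemma equiv_partition_equiv: "equiv UNIV partition_equiv"
proof (rule equivI)
  show "refl partition_equiv"
    unfolding partition_equiv_def by (auto intro!: refl_onI exI[of _ id])
  show "sym partition_equiv"
  proof (rule symI)
    fix p q assume "(p, q) \<in> partition_equiv"
    then obtain f where f: "bij f" "q = map f p"
      by (auto simp: partition_equiv_def)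
    then have "p = map (inv f) q"
      by (simp add: bij_is_inj)
    with bij_imp_bij_inv[OF f(1)] show "(q, p) \<in> partition_equiv"
      by (auto simp: partition_equiv_def)
  qed
  show "trans partition_equiv"
  proof (rule transI)
    fix p q r assume "(p, q) \<in> partition_equiv" "(q, r) \<in> partition_equiv"
    then obtain f g where fg: "bij f" "bij g" "q = map f p" "r = map g q"
      by (auto simp: partition_equiv_def)
    then have "r = map (g \<circ> f) p"
      by simp
    with bij_comp[OF fg(1,2)] show "(p, r) \<in> partition_equiv"
      unfolding partition_equiv_def by blast
  qed
qed (auto simp: partition_equiv_def)

theorem theorem2:
  fixes N :: nat
  assumes "N \<ge> 3"
  shows "card ({p :: nat list. length p = 2 * N + 1 \<and> card (set p) = N
                 \<and> \<not> sorted_partition ((phi_aba ^^ (N - 1)) p)} // partition_equiv)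
         = (N + 1 choose 2) + 2 * (N choose 2)"
proof -
  let ?A = "{p :: nat list. length p = 2 * N + 1 \<and> card (set p) = N
                 \<and> \<not> sorted_partition ((phi_aba ^^ (N - 1)) p)}"
  \<comment> \<open>With first letter \<open>0\<close> and this \<open>U\<close>, the critical words
    serve as representatives of the classes.\<close>
  let ?U = "[1..<N]"
  let ?cl = "\<lambda>w. partition_equiv `` {w}"
  have U: "distinct (0 # ?U)" "2 \<le> length ?U" "length ?U = N - 1"
    using assms by auto
  have "?A // partition_equiv = ?cl ` critical_words ?U 0"
  proof (intro equalityI subsetI)
    fix X assume "X \<in> ?A // partition_equiv"
    then obtain p where p: "p \<in> ?A" and X: "X = ?cl p"
      by (auto simp: quotient_def)
    have N: "N = Suc (Suc (N - 2))" "N - 1 = Suc (N - 2)"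
      using assms by auto
    have "\<exists>V a. distinct (a # V) \<and> length V = Suc (N - 2) \<and> p \<in> critical_words V a"
    proof (rule critical_words_complete)
      show "scattered ((phi_aba ^^ Suc (N - 2)) p) \<noteq> {}"
        using p unfolding N(2)[symmetric] sorted_partition_iff by simp
    qed (use p N(1) in auto)
    then obtain V a where V: "distinct (a # V)" "length V = Suc (N - 2)" "p \<in> critical_words V a"
      by blast
    \<comment> \<open>Renaming \<open>a # V\<close> to the list of numbers below \<open>N\<close>
      turns \<open>p\<close> into an equivalent critical word for the fixed data.\<close>
    then obtain f where f: "bij f" "map f (a # V) = 0 # ?U"
      using bij_extending_distinct_lists[of "a # V" "0 # ?U"] U N by auto
    then have "map f p \<in> critical_words ?U 0"
      using critical_words_map[OF V(3), of f] by simp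
    moreover have "(p, map f p) \<in> partition_equiv"
      using f(1) by (auto simp: partition_equiv_def)
    then have "?cl p = ?cl (map f p)"
      by (rule equiv_class_eq[OF equiv_partition_equiv])
    ultimately show "X \<in> ?cl ` critical_words ?U 0"
      unfolding X by blast
  next
    fix X assume "X \<in> ?cl ` critical_words ?U 0"
    then obtain w where w: "w \<in> critical_words ?U 0" and X: "X = ?cl w"
      by blast
    have "length w = 2 * N + 1"
      using length_critical[OF w] assms by simp
    moreover have "card (set w) = N"
      using set_critical[OF w] assms by simp
    moreover have "\<not> sorted_partition ((phi_aba ^^ (N - 1)) w)"
      using critical_words_scattered[OF U(1,2) w] by (simp add: sorted_partition_iff)
    ultimately show "X \<in> ?A // partition_equiv"
      unfolding X by (intro quotientI) simp
  qed
  moreover have "inj_on ?cl (critical_words ?U 0)"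
  proof (rule inj_onI)
    fix w w' assume w: "w \<in> critical_words ?U 0" "w' \<in> critical_words ?U 0" "?cl w = ?cl w'"
    then have "(w, w') \<in> partition_equiv"
      using eq_equiv_class[OF w(3) equiv_partition_equiv] by simp
    then obtain f where f: "bij f" "w' = map f w"
      by (auto simp: partition_equiv_def)
    \<comment> \<open>Both words have the collapsed image \<open>?L\<close>. The relabelling
      commutes with the map and with collapsing, so it fixes \<open>?L\<close> entrywise; as
      \<open>?L\<close> contains all letters of \<open>w\<close>, it fixes \<open>w\<close>.\<close>
    let ?L = "rev ?U @ rev ?U @ [0]"
    have inj: "inj f"
      using f(1) by (rule bij_is_inj)
    have "map f ?L = ?L"
      using remdups_adj_phi_critical[OF U(1,2) w(1)] remdups_adj_phi_critical[OF U(1,2) w(2)]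
      by (simp only: f(2) phi_map[OF inj] remdups_adj_map_injective[OF inj])
    then have "map f ?L = map id ?L"
      by (simp only: list.map_id)
    then have "f x = x" if "x \<in> set ?L" for x
      using that unfolding map_eq_conv by auto
    moreover have "set w = set ?L"
      using set_critical[OF w(1)] by auto
    ultimately have "map f w = w"
      by (intro map_idI) simp
    with f(2) show "w = w'" by simp
  qed
  ultimately have "card (?A // partition_equiv) = card (critical_words ?U 0)"
    by (simp only: card_image)
  also have "\<dots> = (N + 1 choose 2) + 2 * (N choose 2)"
  proof -
    have "length ?U + 2 = N + 1" "length ?U + 1 = N"
      using assms by auto
    then show ?thesis
      by (simp only: card_critical_words[OF U(1)])
  qed
  finally show ?thesis .
qed

end
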